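(* Let $A,C\in\mathbb C_{\rm H}^{m}$ and $B\in\mathbb C^{m\times m}$ be given, and assume that the matrix equation $BXB^*=C$ is consistent. Let $$M_1=\begin{bmatrix} A & B \\ B^* & 0 \end{bmatrix},\quad M_2=\begin{bmatrix} BA & B^2 \\ B^* & 0 \end{bmatrix},\quad M_3=BAB^*-BC-CB^*.$$ Then the following hold. (a) There exists an $X\in\mathbb C_{\rm H}^{m}$ such that $BX+XB^*\preccurlyeq A$ and $BXB^*=C$ if and only if $$r[\,B^2,\ C-BA\,]+i_-(M_1)-r(M_2)=0\quad\text{and}\quad r[\,B^2,\ C-BA\,]+i_-(M_3)-r[\,B^2,\ CB^*-BAB^*\,]=0.$$ (b) There exists an $X\in\mathbb C_{\rm H}^{m}$ such that $BX+XB^*\prec A$ and $BXB^*=C$ if and only if $$i_+(M_1)\geqslant m\quad\text{and}\quad i_+(BAB^*-BC-CB^* )=r(B).$$ (c) There exists an $X\in\mathbb C_{\rm H}^{m}$ such that $BX+XB^*\succcurlyeq A$ and $BXB^*=C$ if and only if $$r[\,B^2,\ C-BA\,]+i_+(M_1)-r(M_2)=0\quad\text{and}\quad r[\,B^2,\ C-BA\,]+i_+(M_3)-r[\,B^2,\ CB^*-BAB^*\,]=0.$$ (d) There exists an $X\in\mathbb C_{\rm H}^{m}$ such that $BX+XB^*\succ A$ and $BXB^*=C$ if and only if $$i_-(M_1)\geqslant m\quad\text{and}\quad i_-(BAB^*-BC-CB^* )=r(B).$$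
   Context: $\mathbb C_{\rm H}^{m}$ is the set of $m\times m$ complex Hermitian matrices; $r(\cdot)$ is rank; ${}^*$ is conjugate transpose; $i_+(\cdot)$ and $i_-(\cdot)$ are the numbers of positive and negative eigenvalues (with multiplicity) of a Hermitian matrix; $[\,P,\ Q\,]$ is the row block matrix. $P\succcurlyeq Q$ ($P\succ Q$) means that $P$ and $Q$ are Hermitian and $P-Q$ is positive semi-definite (positive definite). *)

theory Defs
  imports
    "HOL-Analysis.Analysis"
    "HOL-Computational_Algebra.Computational_Algebra"
begin

definition adj :: "complex^'n^'m \<Rightarrow> complex^'m^'n" where
  "adj M = (\<chi> i j. cnj (M $ j $ i))"

definition hermitian :: "complex^'n^'n \<Rightarrow> bool" where
  "hermitian M \<longleftrightarrow> adj M = M"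

definition row_block :: "'a^'n^'m \<Rightarrow> 'a^'p^'m \<Rightarrow> 'a^('n + 'p)^'m" where
  "row_block P Q = (\<chi> i j. case j of Inl k \<Rightarrow> P $ i $ k | Inr k \<Rightarrow> Q $ i $ k)"

definition four_block ::
  "'a^'n^'m \<Rightarrow> 'a^'p^'m \<Rightarrow> 'a^'n^'q \<Rightarrow> 'a^'p^'q \<Rightarrow> 'a^('n + 'p)^('m + 'q)" where
  "four_block P Q R S =
     (\<chi> i j. case i of Inl k \<Rightarrow> row_block P Q $ k $ j | Inr k \<Rightarrow> row_block R S $ k $ j)"

definition charpoly :: "'a::comm_ring_1^'n^'n \<Rightarrow> 'a poly" where
  "charpoly M = det (\<chi> i j. (if i = j then [:0, 1:] else 0) - [:M $ i $ j:])"

(* proots is the multiset of roots, so eigenvalues are counted with algebraic multiplicity. *)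

definition inertia_pos :: "complex^'n^'n \<Rightarrow> nat" where
  "inertia_pos M = size {#z \<in># proots (charpoly M). z \<in> \<real> \<and> Re z > 0#}"

definition inertia_neg :: "complex^'n^'n \<Rightarrow> nat" where
  "inertia_neg M = size {#z \<in># proots (charpoly M). z \<in> \<real> \<and> Re z < 0#}"

(* The inner product of the library is the real one, i.e. the real part of the Hermitian one.
   The quadratic form of a Hermitian matrix is real-valued, so nothing is lost. *)

lemma inner_matrix_vector_mult:
  fixes M :: "complex^'n^'n"
  shows "x \<bullet> (M *v x) = Re (\<Sum>i\<in>UNIV. \<Sum>j\<in>UNIV. cnj (x $ i) * M $ i $ j * x $ j)"
proof -
  have "x \<bullet> (M *v x) = (\<Sum>i\<in>UNIV. Re (cnj (x $ i) * (M *v x) $ i))"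
    by (simp add: inner_vec_def inner_complex_def)
  also have "\<dots> = Re (\<Sum>i\<in>UNIV. \<Sum>j\<in>UNIV. cnj (x $ i) * M $ i $ j * x $ j)"
    by (simp only: Re_sum [symmetric] matrix_vector_mult_def vec_lambda_beta
        sum_distrib_left mult.assoc)
  finally show ?thesis .
qed

definition pos_semidef :: "complex^'n^'n \<Rightarrow> bool" where
  "pos_semidef M \<longleftrightarrow> hermitian M \<and> (\<forall>x. x \<bullet> (M *v x) \<ge> 0)"

definition pos_def :: "complex^'n^'n \<Rightarrow> bool" where
  "pos_def M \<longleftrightarrow> hermitian M \<and> (\<forall>x. x \<noteq> 0 \<longrightarrow> x \<bullet> (M *v x) > 0)"

definition loewner_le :: "complex^'n^'n \<Rightarrow> complex^'n^'n \<Rightarrow> bool"  (infix "\<preceq>\<^sub>L" 50) where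
  "P \<preceq>\<^sub>L Q \<longleftrightarrow> hermitian P \<and> hermitian Q \<and> pos_semidef (Q - P)"

definition loewner_less :: "complex^'n^'n \<Rightarrow> complex^'n^'n \<Rightarrow> bool"  (infix "\<prec>\<^sub>L" 50) where
  "P \<prec>\<^sub>L Q \<longleftrightarrow> hermitian P \<and> hermitian Q \<and> pos_def (Q - P)"

end

theory Submission
  imports Defs
begin

text \<open>
  Fix a Hermitian \<open>X\<^sub>0\<close> with \<open>B X\<^sub>0 B\<^sup>* = C\<close>, and put \<open>G = A - B X\<^sub>0 - X\<^sub>0 B\<^sup>*\<close>, \<open>R = range B\<^sup>*\<close> and
  \<open>N = ker B\<^sup>*\<close>. A Hermitian \<open>H\<close> has the form \<open>A - B X - X B\<^sup>*\<close> with \<open>X\<close> Hermitian and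
  \<open>B X B\<^sup>* = C\<close> iff \<open>G - H\<close> vanishes as a form on \<open>R \<times> R\<close> and on \<open>N \<times> N\<close> and kills \<open>R \<inter> N\<close>. So the
  question is whether the form \<open>G\<close>, prescribed on \<open>R\<close>, on \<open>N\<close> and in the rows of \<open>R \<inter> N\<close>, has a
  (semi)definite completion. This needs \<open>G\<close> to be (semi)definite on \<open>N\<close>, where it agrees with \<open>A\<close>,
  and on \<open>R\<close>, where it pulls back along \<open>B\<^sup>*\<close> to \<open>M\<^sub>3\<close>; in the semidefinite case the isotropic vectors
  of \<open>R \<inter> N\<close> must also lie in the kernel of \<open>G\<close>. Splitting off the Schur complement with respect to
  \<open>R \<inter> N\<close> shows that this suffices.

  The inertia of \<open>M\<^sub>1\<close> and \<open>M\<^sub>3\<close> measures the definiteness on \<open>N\<close> and \<open>R\<close>, because \<open>i\<^sub>+\<close> is the largest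
  dimension of a positive subspace. The rank differences in (a) and (c) compare
  \<open>{w. B\<^sup>* B\<^sup>* w = 0 \<and> C w = A B\<^sup>* w}\<close> with the larger spaces \<open>{w. B\<^sup>* B\<^sup>* w = 0 \<and> A B\<^sup>* w \<in> range B}\<close>
  and \<open>{w. B\<^sup>* B\<^sup>* w = 0 \<and> B (A B\<^sup>* w - C w) = 0}\<close>. Parts (c) and (d) are (a) and (b) for
  \<open>(- A, - B, C)\<close>.
\<close>

unbundle no fps_syntax

section \<open>Matrices, adjoints and rank\<close>

lemma adj_nth [simp]: "adj M $ i $ j = cnj (M $ j $ i)"
  by (simp add: adj_def)

lemma adj_adj [simp]: "adj (adj M) = M"
  by (simp add: vec_eq_iff)

lemma adj_add: "adj (M + N) = adj M + adj N"
  and adj_diff: "adj (M - N) = adj M - adj N"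
  and adj_minus: "adj (- M) = - adj M"
  by (simp_all add: vec_eq_iff)

lemma adj_zero [simp]: "adj 0 = 0"
  by (simp add: vec_eq_iff)

lemma adj_mat_1 [simp]: "adj (mat 1) = mat 1"
  by (simp add: vec_eq_iff mat_def)

lemma adj_scaleR: "adj (c *\<^sub>R M) = c *\<^sub>R adj M"
  by (simp add: vec_eq_iff)

lemma adj_mult: "adj (M ** N) = adj N ** adj M"
  by (simp add: vec_eq_iff matrix_matrix_mult_def mult.commute)

lemma matrix_diff_ldistrib: "M ** (N - P) = M ** N - M ** (P :: 'a::ring_1^'n^'m)"
  and matrix_diff_rdistrib: "(N' - P') ** Q = N' ** Q - P' ** (Q :: 'a::ring_1^'n^'m)"
  by (simp_all add: vec_eq_iff matrix_matrix_mult_def algebra_simps sum_subtractf)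

lemma matrix_add_rdistrib: "(N + P) ** Q = N ** Q + P ** (Q :: 'a::semiring_1^'n^'m)"
  by (simp add: vec_eq_iff matrix_matrix_mult_def algebra_simps sum.distrib)

lemma matrix_minus_left: "(- M) ** N = - (M ** (N :: 'a::ring_1^'n^'m))"
  and matrix_minus_right: "M' ** (- N) = - (M' ** N)"
  by (simp_all add: vec_eq_iff matrix_matrix_mult_def sum_negf)

lemma matrix_vector_minus_left: "(- M) *v x = - (M *v (x :: 'a::ring_1^'n))"
  by (simp add: vec_eq_iff matrix_vector_mult_def sum_negf)

lemma scaleR_eq_vector_smult: "c *\<^sub>R (x :: complex^'n) = complex_of_real c *s x"
  by (simp add: vec_eq_iff complex_eq_iff)

lemma matrix_vector_scaleR: "M *v (c *\<^sub>R x) = c *\<^sub>R (M *v (x :: complex^'n))"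
  by (simp add: scaleR_eq_vector_smult vec.scale)

lemma vec_subspace_scaleR: "vec.subspace S \<Longrightarrow> x \<in> S \<Longrightarrow> c *\<^sub>R x \<in> S" for x :: "complex^'n"
  by (simp add: scaleR_eq_vector_smult vec.subspace_scale)

lemma inner_complex_eq_Re: "x \<bullet> y = Re (cnj x * y)"
  by (simp add: inner_complex_def)

lemma inner_adj: "x \<bullet> (M *v y) = (adj M *v x) \<bullet> y"
proof -
  have "x \<bullet> (M *v y) = Re (\<Sum>i\<in>UNIV. \<Sum>j\<in>UNIV. cnj (x $ i) * (M $ i $ j * y $ j))"
    by (simp only: inner_vec_def inner_complex_eq_Re matrix_vector_mult_def vec_lambda_beta
        sum_distrib_left Re_sum)
  also have "\<dots> = Re (\<Sum>j\<in>UNIV. \<Sum>i\<in>UNIV. cnj (x $ i) * (M $ i $ j * y $ j))"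
    by (subst sum.swap) simp
  also have "\<dots> = (adj M *v x) \<bullet> y"
    by (simp only: inner_vec_def inner_complex_eq_Re matrix_vector_mult_def vec_lambda_beta
        sum_distrib_right Re_sum cnj_sum complex_cnj_mult adj_nth complex_cnj_cnj mult.assoc)
      (simp only: mult_ac)
  finally show ?thesis .
qed

lemma matrix_eq_0_if_form_eq_0:
  assumes "\<And>x y. x \<bullet> (M *v y) = 0"
  shows "M = (0 :: complex^'n^'m)"
proof -
  have "M *v y = 0" for y using assms[of "M *v y" y] by simp
  then show ?thesis by (simp add: matrix_eq)
qed

lemma hermitian_inner: "hermitian M \<Longrightarrow> x \<bullet> (M *v y) = (M *v x) \<bullet> y"
  by (simp add: inner_adj hermitian_def)

lemma hermitian_inner_commute: "hermitian M \<Longrightarrow> x \<bullet> (M *v y) = y \<bullet> (M *v x)"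
  by (metis hermitian_inner inner_commute)

text \<open>If \<open>x \<bullet> M z \<noteq> 0\<close>, the form becomes negative at \<open>z + t x\<close> for a small real \<open>t\<close>.\<close>

lemma isotropic_orthogonal:
  assumes M: "hermitian M" and S: "vec.subspace S"
    and nonneg: "\<And>x. x \<in> S \<Longrightarrow> 0 \<le> x \<bullet> (M *v x)"
    and z: "z \<in> S" "z \<bullet> (M *v z) = 0" and x: "x \<in> S"
  shows "x \<bullet> (M *v z) = 0"
proof (rule ccontr)
  \<comment> \<open>For \<open>q > 0\<close> the minimum over real \<open>t\<close> is at
    \<open>- c / q\<close>; the denominator \<open>q + 1\<close> also serves when
    \<open>q = 0\<close> and still makes the value negative.\<close>
  define q c t where "q = x \<bullet> (M *v x)" and "c = x \<bullet> (M *v z)" and "t = - c / (q + 1)"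
  assume "x \<bullet> (M *v z) \<noteq> 0"
  then have c: "c \<noteq> 0" by (simp add: c_def)
  have q: "q \<ge> 0" using nonneg x by (simp add: q_def)
  have zx: "z \<bullet> (M *v x) = c"
    using hermitian_inner_commute[OF M] by (simp add: c_def)
  have "0 \<le> (t *\<^sub>R x + z) \<bullet> (M *v (t *\<^sub>R x + z))"
    by (intro nonneg vec.subspace_add vec_subspace_scaleR S x z)
  also have "\<dots> = t^2 * q + 2 * t * c"
    using z zx by (simp add: matrix_vector_right_distrib matrix_vector_scaleR inner_add_left
        inner_add_right q_def[symmetric] c_def[symmetric] power2_eq_square algebra_simps)
  also have "\<dots> = - (c^2 * (q + 2)) / (q + 1)^2"
  proof -
    have "t^2 * q + 2 * t * c = c^2 * q / (q + 1)^2 - 2 * c^2 * (q + 1) / (q + 1)^2"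
      using q by (simp add: t_def power_divide power2_eq_square)
    then show ?thesis
      by (simp add: diff_divide_distrib[symmetric] algebra_simps)
  qed
  finally have "c^2 * (q + 2) / (q + 1)^2 \<le> 0" by simp
  moreover have "c^2 * (q + 2) / (q + 1)^2 > 0"
    using c q by (intro divide_pos_pos mult_pos_pos) auto
  ultimately show False by simp
qed

text \<open>Orthogonality of \<open>M z\<close> to all vectors includes \<open>x = M z\<close>, so
  its norm vanishes.\<close>

lemma isotropic_kernel:
  assumes "hermitian M" "\<And>x. 0 \<le> x \<bullet> (M *v x)" "z \<bullet> (M *v z) = 0"
  shows "M *v z = 0"
  using isotropic_orthogonal[of M UNIV z "M *v z"] assms by simp

section \<open>Dimensions of kernels and images, and rank\<close>

lemma subspace_kernel: "vec.subspace {x. M *v x = 0}" for M :: "'a::field^'n^'m"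
  by (auto simp: vec.subspace_def vec.add vec.scale)

lemma subspace_range: "vec.subspace (range ((*v) M))" for M :: "'a::field^'n^'m"
  by (rule vec.subspace_image[OF vec.subspace_UNIV])

text \<open>A linear right inverse of \<open>f\<close> on its image splits \<open>S\<close> into a copy of the image and the kernel.\<close>

lemma rank_nullity:
  fixes f :: "'a::field^'n \<Rightarrow> 'a^'m"
  assumes f: "Vector_Spaces.linear (*s) (*s) f" and S: "vec.subspace S"
  shows "vec.dim (f ` S) + vec.dim {x \<in> S. f x = 0} = vec.dim S"
proof -
  interpret f: Vector_Spaces.linear "(*s)" "(*s)" f by (rule f)
  obtain g where g: "range g \<subseteq> S" "Vector_Spaces.linear (*s) (*s) g" "\<And>v. v \<in> f ` S \<Longrightarrow> f (g v) = v"
    using vec.linear_exists_right_inverse_on[OF f S] by blast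
  interpret g: Vector_Spaces.linear "(*s)" "(*s)" g by (rule g)
  have fS: "vec.subspace (f ` S)" by (rule f.subspace_image[OF S])
  let ?T = "g ` f ` S" and ?K = "{x \<in> S. f x = 0}"
  have "inj_on g (vec.span (f ` S))"
    using g(3) by (intro inj_onI) (metis fS vec.span_eq_iff)
  then have T: "vec.dim ?T = vec.dim (f ` S)"
    by (intro vec.dim_image_eq g)
  have subT: "vec.subspace ?T" by (rule g.subspace_image[OF fS])
  have subK: "vec.subspace ?K"
    using S by (auto simp: vec.subspace_def f.add f.scale)
  have "{x + y |x y. x \<in> ?T \<and> y \<in> ?K} = S"
  proof (intro equalityI subsetI)
    fix x assume "x \<in> {x + y |x y. x \<in> ?T \<and> y \<in> ?K}"
    then show "x \<in> S" using g(1) S by (auto intro!: vec.subspace_add)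
  next
    fix x assume x: "x \<in> S"
    then have "x = g (f x) + (x - g (f x))" "g (f x) \<in> ?T" "x - g (f x) \<in> ?K"
      using g S by (auto simp: f.diff intro!: vec.subspace_diff)
    then show "x \<in> {x + y |x y. x \<in> ?T \<and> y \<in> ?K}" by blast
  qed
  moreover have "?T \<inter> ?K = {0}"
  proof
    show "?T \<inter> ?K \<subseteq> {0}" using g(3) by (auto simp: g.zero)
    show "{0} \<subseteq> ?T \<inter> ?K" using vec.subspace_0[OF subT] vec.subspace_0[OF subK] by blast
  qed
  ultimately show ?thesis
    using vec.dim_sums_Int[OF subT subK] T by simp
qed

lemma dim_Int_eq_0:
  fixes S T :: "('a::field^'n) set"
  assumes "vec.subspace S" "vec.subspace T" "S \<inter> T \<subseteq> {0}"
  shows "vec.dim S + vec.dim T \<le> CARD('n)"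
proof -
  have "vec.dim (S \<inter> T) = 0" using assms(3) by (subst vec.dim_eq_0)
  then show ?thesis
    using vec.dim_sums_Int[OF assms(1,2)] dim_subset_UNIV_cart_gen[of "{x + y |x y. x \<in> S \<and> y \<in> T}"]
    by linarith
qed

text \<open>Conjugation is semilinear, not linear, so dimensions are compared through spans: the
  image of a basis spans the image. The reverse inequality holds because conjugation is an
  involution.\<close>

lemma dim_cnj_image: "vec.dim ((\<lambda>x. \<chi> i. cnj (x $ i)) ` S) = vec.dim (S :: (complex^'n) set)"
proof -
  let ?c = "\<lambda>x. \<chi> i. cnj (x $ i) :: complex^'n"
  have le: "vec.dim (?c ` S) \<le> vec.dim S" for S
  proof -
    obtain B where B: "B \<subseteq> S" "vec.independent B" "S \<subseteq> vec.span B" "card B = vec.dim S"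
      using vec.basis_exists by blast
    have "?c x \<in> vec.span (?c ` B)" if "x \<in> vec.span B" for x
      using that
    proof (induction rule: vec.span_induct_alt)
      case base
      have "?c 0 = 0" by (simp add: vec_eq_iff)
      then show ?case by (simp add: vec.span_zero)
    next
      case (step c x y)
      have "?c (c *s x + y) = cnj c *s ?c x + ?c y" by (simp add: vec_eq_iff)
      moreover have "?c x \<in> vec.span (?c ` B)"
        using step by (intro vec.span_base imageI)
      ultimately show ?case using step.IH by (simp only:) (intro vec.span_add vec.span_scale)
    qed
    then have "?c ` S \<subseteq> vec.span (?c ` B)" using B by auto
    moreover have "finite B" using B(2) vec.finiteI_independent by blast
    ultimately have "vec.dim (?c ` S) \<le> card (?c ` B)"
      by (intro vec.dim_le_card) auto
    also have "\<dots> \<le> card B" by (rule card_image_le) fact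
    finally show ?thesis using B by simp
  qed
  have "?c ` ?c ` S = S" by (simp add: image_comp comp_def)
  then show ?thesis using le[of S] le[of "?c ` S"] by simp
qed

text \<open>The row space is the range of the transpose, and the kernel of \<open>adj M\<close> is
  the entrywise conjugate of the kernel of the transpose. All ranks below are computed through this
  left kernel.\<close>

lemma rank_add_dim_kernel_adj:
  fixes M :: "complex^'n^'m"
  shows "rank M + vec.dim {x. adj M *v x = 0} = CARD('m)"
proof -
  let ?c = "\<lambda>x. \<chi> i. cnj (x $ i) :: complex^'m"
  have "rank M = vec.dim (range ((*v) (transpose M)))"
  proof -
    have "vec.span (rows M) = range ((*v) (transpose M))"
    proof
      have "row i M = transpose M *v axis i 1" for i
        by (simp add: vec_eq_iff row_def matrix_vector_mult_def transpose_def axis_def if_distrib cong: if_cong)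
      then have "rows M \<subseteq> range ((*v) (transpose M))"
        by (auto simp: rows_def)
      then show "vec.span (rows M) \<subseteq> range ((*v) (transpose M))"
        by (intro vec.span_minimal subspace_range)
      show "range ((*v) (transpose M)) \<subseteq> vec.span (rows M)"
        using matrix_vector_mult_in_columnspace_gen[of "transpose M"] by (auto simp: columns_transpose)
    qed
    then show ?thesis using vec.dim_span[of "rows M"] by (simp only: row_rank_def_gen)
  qed
  moreover have "{x. adj M *v x = 0} = ?c ` {x. transpose M *v x = 0}"
  proof -
    have *: "adj M *v ?c x = (\<chi> i. cnj ((transpose M *v x) $ i))" for x
      by (simp add: vec_eq_iff matrix_vector_mult_def transpose_def)
    have "adj M *v ?c x = 0 \<longleftrightarrow> transpose M *v x = 0" for x
      unfolding * by (simp add: vec_eq_iff)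
    moreover have "?c (?c x) = x" for x by (simp add: vec_eq_iff)
    ultimately have "x \<in> {x. adj M *v x = 0} \<longleftrightarrow> x \<in> ?c ` {x. transpose M *v x = 0}" for x
      unfolding image_iff mem_Collect_eq bex_simps by (metis (no_types))
    then show ?thesis by blast
  qed
  ultimately show ?thesis
    using rank_nullity[OF matrix_vector_mul_linear_gen[of "transpose M"] vec.subspace_UNIV]
    by (simp only: dim_cnj_image vec_dim_card UNIV_I simp_thms)
qed

section \<open>Spectral theorem and inertia\<close>

text \<open>Vanishing of \<open>\<bullet>\<close> is only real orthogonality. A unitary matrix of
  eigenvectors needs the full Hermitian product, whose real part is
  \<open>\<bullet>\<close>.\<close>

definition hinner :: "complex^'n \<Rightarrow> complex^'n \<Rightarrow> complex" where
  "hinner x y = (\<Sum>i\<in>UNIV. cnj (x $ i) * y $ i)"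

lemma Re_hinner: "Re (hinner x y) = x \<bullet> y"
  by (simp only: hinner_def inner_vec_def inner_complex_eq_Re Re_sum)

lemma hinner_self: "hinner x x = of_real ((norm x)\<^sup>2)"
proof -
  have "Im (hinner x x) = 0" by (simp add: hinner_def)
  then show ?thesis
    using Re_hinner[of x x] by (simp add: complex_eq_iff power2_norm_eq_inner)
qed

lemma cnj_hinner: "cnj (hinner x y) = hinner y x"
  by (simp add: hinner_def mult.commute)

lemma hinner_smult_left: "hinner (c *s x) y = cnj c * hinner x y"
  by (simp add: hinner_def sum_distrib_left mult_ac)

lemma hinner_adj: "hinner x (M *v y) = hinner (adj M *v x) y"
proof -
  have "hinner x (M *v y) = (\<Sum>i\<in>UNIV. \<Sum>j\<in>UNIV. cnj (x $ i) * (M $ i $ j * y $ j))"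
    by (simp only: hinner_def matrix_vector_mult_def vec_lambda_beta sum_distrib_left)
  also have "\<dots> = (\<Sum>j\<in>UNIV. \<Sum>i\<in>UNIV. cnj (x $ i) * (M $ i $ j * y $ j))"
    by (subst sum.swap) simp
  also have "\<dots> = hinner (adj M *v x) y"
    by (simp only: hinner_def matrix_vector_mult_def vec_lambda_beta
        sum_distrib_right cnj_sum complex_cnj_mult adj_nth complex_cnj_cnj mult.assoc)
      (simp only: mult_ac)
  finally show ?thesis .
qed

lemma continuous_on_form: "continuous_on S (\<lambda>x :: complex^'n. x \<bullet> (M *v x))"
  by (intro continuous_intros linear_continuous_on matrix_vector_mul_bounded_linear)

lemma compact_kernel_Int_sphere:
  "compact ({x. Q *v x = 0} \<inter> sphere 0 1)" for Q :: "complex^'n^'m"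
proof -
  have "closed {x. Q *v x = 0}"
    by (intro closed_Collect_eq linear_continuous_on matrix_vector_mul_bounded_linear continuous_on_const)
  then show ?thesis by (simp add: closed_Int_compact)
qed

text \<open>Let \<open>x\<close> maximize the form of \<open>M\<close> on the unit sphere of the
  kernel of \<open>Q\<close>, with maximum \<open>l\<close>. Then \<open>K = l I - M\<close> is
  nonnegative on this kernel and \<open>x\<close> is isotropic for \<open>K\<close>, so
  \<open>K x\<close> is orthogonal to the kernel. By invariance \<open>K x\<close> also lies in it
  and therefore vanishes.\<close>

lemma eigenvector_in_invariant_kernel:
  fixes M :: "complex^'n^'n" and Q :: "complex^'n^'m"
  assumes M: "hermitian M" and inv: "\<And>x. Q *v x = 0 \<Longrightarrow> Q *v (M *v x) = 0"
    and ex: "\<exists>x. x \<noteq> 0 \<and> Q *v x = 0"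
  obtains x and l :: real where "norm x = 1" "Q *v x = 0" "M *v x = of_real l *s x"
proof -
  let ?S = "{x. Q *v x = 0}"
  have S: "vec.subspace ?S" by (rule subspace_kernel)
  obtain x0 where x0: "x0 \<noteq> 0" "Q *v x0 = 0" using ex by blast
  have "(1 / norm x0) *\<^sub>R x0 \<in> ?S \<inter> sphere 0 1"
    using x0 vec_subspace_scaleR[OF S, of x0] by simp
  then obtain x where x: "x \<in> ?S \<inter> sphere 0 1"
    and max: "\<And>y. y \<in> ?S \<inter> sphere 0 1 \<Longrightarrow> y \<bullet> (M *v y) \<le> x \<bullet> (M *v x)"
    using continuous_attains_sup[OF compact_kernel_Int_sphere _ continuous_on_form[of _ M], of Q]
    by blast
  define l K where "l = x \<bullet> (M *v x)" and "K = mat (of_real l) - M"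
  have Kv: "K *v y = l *\<^sub>R y - M *v y" for y
    by (simp add: K_def vec_eq_iff matrix_vector_mult_def mat_def left_diff_distrib sum_subtractf
        if_distrib[of "\<lambda>c. c * _"] cong: if_cong) (simp add: scaleR_conv_of_real)
  have "hermitian K"
    using M by (simp add: K_def hermitian_def vec_eq_iff mat_def)
  have nonneg: "0 \<le> y \<bullet> (K *v y)" if "y \<in> ?S" for y
  proof (cases "y = 0")
    case False
    define z where "z = (1 / norm y) *\<^sub>R y"
    have "z \<in> ?S \<inter> sphere 0 1"
      using False that vec_subspace_scaleR[OF S, of y] by (simp add: z_def)
    then have "z \<bullet> (M *v z) \<le> l" using max by (simp add: l_def)
    moreover have "y = norm y *\<^sub>R z" using False by (simp add: z_def)
    then have "y \<bullet> (M *v y) = (norm y)\<^sup>2 * (z \<bullet> (M *v z))"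
      by (metis inner_scaleR_left inner_scaleR_right matrix_vector_scaleR mult.assoc power2_eq_square)
    ultimately have "y \<bullet> (M *v y) \<le> (norm y)\<^sup>2 * l"
      by (simp add: mult_left_mono)
    then show ?thesis
      by (simp add: Kv inner_diff_right power2_norm_eq_inner mult.commute)
  qed simp
  have "x \<bullet> (K *v x) = 0"
    using x by (simp add: Kv inner_diff_right l_def dot_square_norm)
  moreover have "K *v x \<in> ?S"
    using x inv by (simp add: Kv vec.diff matrix_vector_scaleR)
  ultimately have "(K *v x) \<bullet> (K *v x) = 0"
    using isotropic_orthogonal[OF \<open>hermitian K\<close> S nonneg] x by blast
  then have "M *v x = of_real l *s x"
    by (simp add: Kv scaleR_eq_vector_smult)
  with x show thesis by (intro that[of x l]) auto
qed

text \<open>The next eigenvector is sought in the orthogonal complement of those already found. This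
  complement is the kernel of \<open>Q\<close> and is invariant under \<open>M\<close>.\<close>

lemma orthonormal_eigenvectors:
  fixes M :: "complex^'n^'n"
  assumes M: "hermitian M" and "finite I"
  shows "\<exists>(u :: 'n \<Rightarrow> complex^'n) (d :: 'n \<Rightarrow> real).
    (\<forall>i\<in>I. M *v u i = of_real (d i) *s u i) \<and>
    (\<forall>i\<in>I. \<forall>j\<in>I. hinner (u i) (u j) = (if i = j then 1 else 0))"
  using \<open>finite I\<close>
proof (induction I rule: finite_induct)
  case (insert k I)
  then obtain u :: "'n \<Rightarrow> complex^'n" and d :: "'n \<Rightarrow> real"
    where eig: "\<And>i. i \<in> I \<Longrightarrow> M *v u i = of_real (d i) *s u i"
      and orth: "\<And>i j. i \<in> I \<Longrightarrow> j \<in> I \<Longrightarrow> hinner (u i) (u j) = (if i = j then 1 else 0)"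
    by blast
  define Q :: "complex^'n^'n" where "Q = (\<chi> i j. if i \<in> I then cnj (u i $ j) else 0)"
  have Q: "(Q *v x) $ i = (if i \<in> I then hinner (u i) x else 0)" for x i
    by (simp add: Q_def matrix_vector_mult_def hinner_def)
  have Q0: "Q *v x = 0 \<longleftrightarrow> (\<forall>i\<in>I. hinner (u i) x = 0)" for x
    by (auto simp: vec_eq_iff Q)
  have inv: "Q *v (M *v x) = 0" if "Q *v x = 0" for x
    using that M eig by (simp add: Q0 hinner_adj hermitian_def hinner_smult_left)
  \<comment> \<open>Row \<open>k\<close> of \<open>Q\<close> is zero because \<open>k\<close> is a
    new index; a square matrix that is not onto has a nontrivial kernel.\<close>
  have "\<not> surj ((*v) Q)"
  proof
    assume "surj ((*v) Q)"
    then obtain x where "Q *v x = axis k 1" by (metis surjD)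
    then have "(Q *v x) $ k = 1" by simp
    then show False using insert.hyps by (simp add: Q)
  qed
  then have "\<not> inj ((*v) Q)"
    using vec.linear_inj_imp_surj[OF matrix_vector_mul_linear_gen] by blast
  then have "\<exists>x. x \<noteq> 0 \<and> Q *v x = 0"
    using matrix_left_invertible_ker[of Q] matrix_left_invertible_injective[of Q] by blast
  then obtain x and l :: real where x: "norm x = 1" "Q *v x = 0" "M *v x = of_real l *s x"
    using eigenvector_in_invariant_kernel[OF M inv] by blast
  have xx: "hinner x x = 1" using x by (simp add: hinner_self)
  have ux: "hinner (u i) x = 0" "hinner x (u i) = 0" if "i \<in> I" for i
    using x(2) that cnj_hinner[of "u i" x] by (auto simp: Q0)
  show ?case
    using insert.hyps eig orth x xx ux
    by (intro exI[of _ "u(k := x)"] exI[of _ "d(k := l)"]) auto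
qed simp

definition diag_mat :: "('n \<Rightarrow> 'a::zero) \<Rightarrow> 'a^'n^'n" where
  "diag_mat d = (\<chi> i j. if i = j then d i else 0)"

theorem hermitian_spectral:
  fixes M :: "complex^'n^'n"
  assumes "hermitian M"
  obtains U :: "complex^'n^'n" and d :: "'n \<Rightarrow> real"
  where "adj U ** U = mat 1" "M ** U = U ** diag_mat (\<lambda>i. of_real (d i))"
proof -
  obtain u :: "'n \<Rightarrow> complex^'n" and d :: "'n \<Rightarrow> real"
    where eig: "\<And>i. M *v u i = of_real (d i) *s u i"
      and orth: "\<And>i j. hinner (u i) (u j) = (if i = j then 1 else 0)"
    using orthonormal_eigenvectors[OF assms finite[of UNIV]] by blast
  define U :: "complex^'n^'n" where "U = (\<chi> i j. u j $ i)"
  have "adj U ** U = mat 1"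
    using orth by (simp add: vec_eq_iff matrix_matrix_mult_def U_def hinner_def mat_def)
  moreover have "M ** U = U ** diag_mat (\<lambda>i. of_real (d i))"
  proof -
    have "(M ** U) $ i $ j = (M *v u j) $ i" for i j
      by (simp add: matrix_matrix_mult_def matrix_vector_mult_def U_def)
    then show ?thesis
      by (simp add: vec_eq_iff matrix_matrix_mult_def eig U_def diag_mat_def
          if_distrib[of "\<lambda>c. _ * c"] mult.commute cong: if_cong)
  qed
  ultimately show thesis by (rule that)
qed

section \<open>Characteristic polynomials and counting eigenvalues\<close>

text \<open>The relation is lifted to polynomial matrices by the embedding \<open>c\<close> of
  constants. The scalar matrix \<open>X\<close> commutes with everything, and
  \<open>det (c U)\<close> cancels because \<open>det (c V)\<close> is its inverse.\<close>

lemma charpoly_similar: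
  fixes M D U V :: "'a::comm_ring_1^'n^'n"
  assumes "M ** U = U ** D" "V ** U = mat 1"
  shows "charpoly M = charpoly D"
proof -
  define X :: "'a poly^'n^'n" where "X = (\<chi> i j. if i = j then [:0, 1:] else 0)"
  define c where "c A = (\<chi> i j. [:A $ i $ j:])" for A :: "'a^'n^'n"
  have const_sum: "(\<Sum>k\<in>K. [:f k:]) = [:\<Sum>k\<in>K. f k:]" for K :: "'n set" and f :: "'n \<Rightarrow> 'a"
    by (induction K rule: infinite_finite_induct) auto
  have c_mult: "c (A ** B) = c A ** c B" for A B
    by (simp add: c_def vec_eq_iff matrix_matrix_mult_def const_sum mult.commute)
  have X_comm: "X ** A = A ** X" for A
    by (simp add: X_def vec_eq_iff matrix_matrix_mult_def if_distrib[of "\<lambda>c. c * _"]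
        if_distrib[of "\<lambda>c. _ * c"] cong: if_cong)
  have charpoly: "charpoly A = det (X - c A)" for A
    unfolding charpoly_def by (rule arg_cong[where f=det]) (simp add: X_def c_def vec_eq_iff)
  have VU: "det (c V) * det (c U) = 1"
  proof -
    have "c (mat 1) = mat 1" by (simp add: c_def vec_eq_iff mat_def)
    then show ?thesis by (metis assms(2) c_mult det_mul det_I)
  qed
  have "(X - c M) ** c U = c U ** (X - c D)"
    by (simp add: matrix_diff_ldistrib matrix_diff_rdistrib X_comm c_mult[symmetric] assms)
  then have "det (X - c M) * det (c U) = det (c U) * det (X - c D)"
    using arg_cong[of _ _ det] by (simp only: det_mul[symmetric])
  then have "(det (c V) * det (c U)) * det (X - c M) = (det (c V) * det (c U)) * det (X - c D)"
    by (simp only: mult.assoc mult.commute[of "det (c U)" "det (X - c M)"])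
  then show ?thesis
    unfolding charpoly VU by simp
qed

lemma proots_charpoly_diag:
  "proots (charpoly (diag_mat d)) = image_mset d (mset_set UNIV)"
  for d :: "'n::finite \<Rightarrow> complex"
proof -
  have "charpoly (diag_mat d) = (\<Prod>i\<in>UNIV. [:- d i, 1:])"
    unfolding charpoly_def by (subst det_diagonal) (simp_all add: diag_mat_def)
  then have "proots (charpoly (diag_mat d)) = (\<Sum>i\<in>UNIV. {#d i#})"
    by (simp add: proots_prod proots_linear_factor)
  also have "\<dots> = image_mset d (mset_set UNIV)"
    by (simp add: sum_unfold_sum_mset)
  finally show ?thesis .
qed

lemma inertia_eq_card:
  fixes M U V :: "complex^'n^'n"
  assumes "M ** U = U ** diag_mat (\<lambda>i. of_real (d i))" "V ** U = mat 1"
  shows "inertia_pos M = card {i. d i > 0}" "inertia_neg M = card {i. d i < 0}"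
proof -
  have "proots (charpoly M) = image_mset (\<lambda>i. of_real (d i)) (mset_set UNIV)"
    using charpoly_similar[OF assms] by (simp add: proots_charpoly_diag)
  then show "inertia_pos M = card {i. d i > 0}" "inertia_neg M = card {i. d i < 0}"
    by (simp_all add: inertia_pos_def inertia_neg_def filter_mset_image_mset filter_mset_mset_set)
qed

text \<open>The eigenvectors stay and the eigenvalues change sign. Facts about
  \<open>inertia_neg\<close> are derived in this way from those about
  \<open>inertia_pos\<close>.\<close>

lemma inertia_pos_minus:
  fixes M :: "complex^'n^'n"
  assumes "hermitian M"
  shows "inertia_pos (- M) = inertia_neg M"
proof -
  obtain U :: "complex^'n^'n" and d :: "'n \<Rightarrow> real"
    where U: "adj U ** U = mat 1" "M ** U = U ** diag_mat (\<lambda>i. of_real (d i))"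
    using hermitian_spectral[OF assms] by blast
  have "(- M) ** U = U ** (- diag_mat (\<lambda>i. of_real (d i)))"
    by (simp add: matrix_minus_left matrix_minus_right U)
  also have "- diag_mat (\<lambda>i. of_real (d i)) = (diag_mat (\<lambda>i. of_real (- d i)) :: complex^'n^'n)"
    by (simp add: diag_mat_def vec_eq_iff)
  finally have "inertia_pos (- M) = card {i. - d i > 0}"
    by (rule inertia_eq_card(1)) (rule U)
  then show ?thesis using inertia_eq_card(2)[OF U(2,1)] by simp
qed

definition posdef_on :: "complex^'n^'n \<Rightarrow> (complex^'n) set \<Rightarrow> bool" where
  "posdef_on M S \<longleftrightarrow> (\<forall>x\<in>S. x \<noteq> 0 \<longrightarrow> 0 < x \<bullet> (M *v x))"

text \<open>The eigenvectors with positive eigenvalue span a positive subspace. The span of the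
  others has a nonpositive form, so it meets every positive subspace only in zero, and counting
  dimensions gives the bound.\<close>

lemma inertia_pos_subspaces:
  fixes M :: "complex^'n^'n"
  assumes "hermitian M"
  shows "\<exists>S. vec.subspace S \<and> posdef_on M S \<and> vec.dim S = inertia_pos M"
    and "vec.subspace S \<Longrightarrow> posdef_on M S \<Longrightarrow> vec.dim S \<le> inertia_pos M"
proof -
  obtain U :: "complex^'n^'n" and d :: "'n \<Rightarrow> real"
    where U: "adj U ** U = mat 1" "M ** U = U ** diag_mat (\<lambda>i. of_real (d i))"
    using hermitian_spectral[OF assms] by blast
  let ?P = "{i. d i > 0}"
  let ?E = "\<lambda>P. {c :: complex^'n. \<forall>i. i \<notin> P \<longrightarrow> c $ i = 0}"
  have pos: "inertia_pos M = card ?P" by (rule inertia_eq_card[OF U(2,1)])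
  have UU: "adj U *v (U *v c) = c" for c
    by (simp add: matrix_vector_mul_assoc U)
  have "inj ((*v) U)" by (metis UU injI)
  then have inj: "inj_on ((*v) U) A" for A by (rule inj_on_subset) simp
  have diag: "diag_mat (\<lambda>i. of_real (d i)) *v c = (\<chi> i. d i *\<^sub>R c $ i)" for c :: "complex^'n"
    by (simp add: diag_mat_def matrix_vector_mult_def vec_eq_iff if_distrib[of "\<lambda>c. c * _"]
        scaleR_conv_of_real cong: if_cong)
  have form: "(U *v c) \<bullet> (M *v (U *v c)) = (\<Sum>i\<in>UNIV. d i * (cmod (c $ i))\<^sup>2)" for c
  proof -
    have "(U *v c) \<bullet> (M *v (U *v c)) = (U *v c) \<bullet> (U *v (diag_mat (\<lambda>i. of_real (d i)) *v c))"
      by (simp add: matrix_vector_mul_assoc U)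
    also have "\<dots> = c \<bullet> (diag_mat (\<lambda>i. of_real (d i)) *v c)"
      by (simp only: inner_adj[of "U *v c" U] UU)
    finally show ?thesis by (simp add: diag inner_vec_def power2_norm_eq_inner)
  qed
  have E: "vec.subspace (?E P)" for P by (auto simp: vec.subspace_def)
  then have UE: "vec.subspace ((*v) U ` ?E P)" for P by (rule vec.subspace_image)
  have dim: "vec.dim ((*v) U ` ?E P) = card P" for P
    by (subst vec.dim_image_eq) (auto intro: inj dim_substandard_cart)
  have "posdef_on M ((*v) U ` ?E ?P)"
    unfolding posdef_on_def
  proof (safe)
    fix c assume c: "\<forall>i. i \<notin> ?P \<longrightarrow> c $ i = 0" and "U *v c \<noteq> 0"
    then have "c \<noteq> 0" by auto
    then obtain i where "c $ i \<noteq> 0" by (auto simp: vec_eq_iff)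
    with c have i: "d i > 0" "c $ i \<noteq> 0" by auto
    have "0 \<le> d i * (cmod (c $ i))\<^sup>2" for i
    proof (cases "d i > 0")
      case False
      then have "c $ i = 0" using c by simp
      then show ?thesis by simp
    qed simp
    then show "0 < (U *v c) \<bullet> (M *v (U *v c))"
      unfolding form using i by (intro sum_pos2[of _ i]) auto
  qed
  then show "\<exists>S. vec.subspace S \<and> posdef_on M S \<and> vec.dim S = inertia_pos M"
    using UE[of ?P] dim[of ?P] pos by (intro exI[of _ "(*v) U ` ?E ?P"] conjI) simp_all
  assume S: "vec.subspace S" "posdef_on M S"
  have "S \<inter> ((*v) U ` ?E (- ?P)) \<subseteq> {0}"
  proof (safe, rule ccontr)
    fix c assume c: "\<forall>i. i \<notin> - ?P \<longrightarrow> c $ i = 0" and "U *v c \<in> S" "U *v c \<noteq> 0"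
    then have "0 < (U *v c) \<bullet> (M *v (U *v c))" using S by (simp add: posdef_on_def)
    moreover have "d i * (cmod (c $ i))\<^sup>2 \<le> 0" for i
    proof (cases "d i > 0")
      case True
      then have "c $ i = 0" using c by simp
      then show ?thesis by simp
    qed (simp add: mult_nonpos_nonneg)
    then have "(U *v c) \<bullet> (M *v (U *v c)) \<le> 0"
      unfolding form by (intro sum_nonpos) auto
    ultimately show False by simp
  qed
  then have "vec.dim S + card (- ?P) \<le> CARD('n)"
    using dim_Int_eq_0[OF S(1) UE[of "- ?P"]] by (simp only: dim)
  moreover have "card ?P + card (- ?P) = CARD('n)"
    by (subst card_Un_disjoint[symmetric]) (auto simp: Compl_partition)
  ultimately show "vec.dim S \<le> inertia_pos M"
    unfolding pos by linarith
qed

section \<open>Inertia and rank of block matrices\<close>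

definition vjoin :: "'a^'m \<Rightarrow> 'a^'n \<Rightarrow> 'a^('m + 'n)" where
  "vjoin x y = (\<chi> i. case i of Inl k \<Rightarrow> x $ k | Inr k \<Rightarrow> y $ k)"

definition vfst :: "'a^('m::finite + 'n::finite) \<Rightarrow> 'a^'m" where
  "vfst v = (\<chi> i. v $ Inl i)"

definition vsnd :: "'a^('m::finite + 'n::finite) \<Rightarrow> 'a^'n" where
  "vsnd v = (\<chi> i. v $ Inr i)"

lemma vfst_vjoin [simp]: "vfst (vjoin x y) = x"
  and vsnd_vjoin [simp]: "vsnd (vjoin x y) = y"
  by (simp_all add: vfst_def vsnd_def vjoin_def vec_eq_iff)

lemma vjoin_eq_iff [simp]: "vjoin x y = vjoin x' y' \<longleftrightarrow> x = x' \<and> y = y'"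
  by (metis vfst_vjoin vsnd_vjoin)

lemma vjoin_vfst_vsnd [simp]: "vjoin (vfst v) (vsnd v) = v"
  by (simp add: vfst_def vsnd_def vjoin_def vec_eq_iff split: sum.split)

lemma vjoin_zero [simp]: "vjoin 0 0 = 0"
  by (simp add: vjoin_def vec_eq_iff split: sum.split)

lemma vjoin_eq_0_iff [simp]: "vjoin x y = 0 \<longleftrightarrow> x = 0 \<and> y = 0"
  by (metis vjoin_eq_iff vjoin_zero)

lemma vfst_0 [simp]: "vfst 0 = 0" and vsnd_0 [simp]: "vsnd 0 = 0"
  by (simp_all add: vfst_def vsnd_def vec_eq_iff)

lemma vfst_add [simp]: "vfst (u + v) = vfst u + vfst v"
  and vsnd_add [simp]: "vsnd (u + v) = vsnd u + vsnd v"
  and vfst_smult [simp]: "vfst (c *s v) = c *s vfst v"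
  and vsnd_smult [simp]: "vsnd (c *s v) = c *s vsnd v"
  by (simp_all add: vfst_def vsnd_def vec_eq_iff)

lemma vec_join_eq_iff: "u = v \<longleftrightarrow> vfst u = vfst v \<and> vsnd u = vsnd v"
  by (metis vjoin_vfst_vsnd)

lemma sum_UNIV_Plus: "(\<Sum>i\<in>UNIV. f i) = (\<Sum>i\<in>UNIV. f (Inl i)) + (\<Sum>i\<in>UNIV. f (Inr i))"
  for f :: "'a::finite + 'b::finite \<Rightarrow> 'c::comm_monoid_add"
  by (simp add: UNIV_Plus_UNIV[symmetric] sum.Plus del: UNIV_Plus_UNIV)

lemma inner_vjoin: "vjoin x y \<bullet> vjoin x' y' = x \<bullet> x' + y \<bullet> y'"
  by (simp add: inner_vec_def sum_UNIV_Plus vjoin_def)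

lemma four_block_mult:
  "four_block P Q R S *v vjoin x y = vjoin (P *v x + Q *v y) (R *v x + S *v y)"
  by (simp add: matrix_vector_mult_def sum_UNIV_Plus vjoin_def row_block_def four_block_def vec_eq_iff
      split: sum.split)

lemma adj_row_block_mult: "adj (row_block P Q) *v x = vjoin (adj P *v x) (adj Q *v x)"
  by (simp add: matrix_vector_mult_def vjoin_def row_block_def vec_eq_iff split: sum.split)

lemma adj_four_block: "adj (four_block P Q R S) = four_block (adj P) (adj R) (adj Q) (adj S)"
  by (simp add: row_block_def four_block_def vec_eq_iff split: sum.split)

lemma four_block_minus: "- four_block P Q R S = four_block (- P) (- Q) (- R) (- S)"
  by (simp add: row_block_def four_block_def vec_eq_iff split: sum.split)

lemma vec_linearI:
  fixes f :: "'a::field^'n \<Rightarrow> 'a^'m"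
  assumes "\<And>x y. f (x + y) = f x + f y" "\<And>c x. f (c *s x) = c *s f x"
  shows "Vector_Spaces.linear (*s) (*s) f"
  using assms by (simp add: Vector_Spaces.linear_iff vec.vector_space_axioms)

lemma dim_times:
  fixes S :: "('a::field^'m) set" and T :: "('a^'n) set"
  assumes S: "vec.subspace S" and T: "vec.subspace T"
  shows "vec.subspace {v. vfst v \<in> S \<and> vsnd v \<in> T}"
    and "vec.dim {v. vfst v \<in> S \<and> vsnd v \<in> T} = vec.dim S + vec.dim T"
proof -
  let ?P = "{v. vfst v \<in> S \<and> vsnd v \<in> T}"
  show P: "vec.subspace ?P"
    using S T by (auto simp: vec.subspace_def)
  have lin: "Vector_Spaces.linear (*s) (*s) (vfst :: 'a^('m + 'n) \<Rightarrow> _)"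
    by (intro vec_linearI) simp_all
  have linj: "Vector_Spaces.linear (*s) (*s) (vjoin 0 :: 'a^'n \<Rightarrow> 'a^('m + 'n))"
    by (intro vec_linearI) (simp_all add: vec_join_eq_iff)
  have "vfst ` ?P = S"
  proof (intro equalityI subsetI)
    fix x assume "x \<in> S"
    then show "x \<in> vfst ` ?P"
      using vec.subspace_0[OF T] by (intro image_eqI[of _ _ "vjoin x 0"]) auto
  qed auto
  moreover have "{v \<in> ?P. vfst v = 0} = vjoin 0 ` T"
  proof (intro equalityI subsetI)
    fix v assume "v \<in> {v \<in> ?P. vfst v = 0}"
    then show "v \<in> vjoin 0 ` T"
      by (intro image_eqI[of _ _ "vsnd v"]) (auto simp: vec_join_eq_iff)
  qed (use vec.subspace_0[OF S] in auto)
  moreover have "vec.dim (vjoin 0 ` T :: ('a^('m + 'n)) set) = vec.dim T"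
    by (intro vec.dim_image_eq linj inj_onI) simp
  ultimately show "vec.dim ?P = vec.dim S + vec.dim T"
    using rank_nullity[OF lin P] by simp
qed

text \<open>If \<open>x = B y\<close>, then \<open>x \<bullet> x\<close> equals the inner product of
  \<open>adj B *v x\<close> with \<open>y\<close>, which is zero.\<close>

lemma range_Int_kernel_adj: "x \<in> range ((*v) B) \<Longrightarrow> adj B *v x = 0 \<Longrightarrow> x = 0"
  using inner_adj[of "_ :: complex^_" B] by (metis imageE inner_commute inner_eq_zero_iff inner_zero_left)

lemma dim_range_add_dim_kernel:
  "vec.dim (range ((*v) B)) + vec.dim {x. B *v x = 0} = CARD('n)" for B :: "'a::field^'n^'m"
  using rank_nullity[OF matrix_vector_mul_linear_gen[of B] vec.subspace_UNIV]
  by (simp only: vec_dim_card UNIV_I simp_thms)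

lemma dim_range_le_rank: "vec.dim (range ((*v) B)) \<le> rank B" for B :: "complex^'n^'m"
proof -
  have "range ((*v) B) \<inter> {x. adj B *v x = 0} \<subseteq> {0}"
    using range_Int_kernel_adj by auto
  from dim_Int_eq_0[OF subspace_range subspace_kernel this]
  show ?thesis using rank_add_dim_kernel_adj[of B] by linarith
qed

text \<open>This is the equality of row and column rank. The nullity formulas identify the range
  dimension of \<open>B\<close> with the rank of \<open>adj B\<close> and conversely, so the
  inequality for both matrices forces equality.\<close>

lemma dim_range_eq_rank: "vec.dim (range ((*v) B)) = rank B"
  and dim_range_adj_eq_rank: "vec.dim (range ((*v) (adj B))) = rank B" for B :: "complex^'n^'m"
  using dim_range_le_rank[of B] dim_range_le_rank[of "adj B"] rank_add_dim_kernel_adj[of B]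
    rank_add_dim_kernel_adj[of "adj B"] dim_range_add_dim_kernel[of B] dim_range_add_dim_kernel[of "adj B"]
  by simp_all

lemma rank_row_block:
  fixes P :: "complex^'n^'m" and Q :: "complex^'p^'m"
  shows "rank (row_block P Q) + vec.dim {w. adj P *v w = 0 \<and> adj Q *v w = 0} = CARD('m)"
  using rank_add_dim_kernel_adj[of "row_block P Q"] by (simp add: adj_row_block_mult)

text \<open>The left kernel consists of the pairs \<open>(w, v)\<close> with
  \<open>A B\<^sup>* w + B v = 0\<close> and \<open>B\<^sup>* B\<^sup>* w = 0\<close>. Its first
  components form the displayed set, and the pairs with \<open>w = 0\<close> form a copy of the
  kernel of \<open>B\<close>.\<close>

lemma rank_M2:
  fixes A B :: "complex^'m^'m"
  assumes A: "hermitian A"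
  shows "rank (four_block (B ** A) (B ** B) (adj B) 0) +
      vec.dim {w. adj B *v (adj B *v w) = 0 \<and> A *v (adj B *v w) \<in> range ((*v) B)} =
    rank B + CARD('m)"
proof -
  let ?M = "four_block (B ** A) (B ** B) (adj B) 0"
  let ?K = "{v. adj ?M *v v = 0}"
  let ?I = "{w. adj B *v (adj B *v w) = 0 \<and> A *v (adj B *v w) \<in> range ((*v) B)}"
  have "adj A = A" using A by (simp add: hermitian_def)
  have *: "adj ?M *v vjoin w v = 0 \<longleftrightarrow> A *v (adj B *v w) + B *v v = 0 \<and> adj B *v (adj B *v w) = 0" for w v
    by (simp add: adj_four_block adj_mult \<open>adj A = A\<close> four_block_mult matrix_vector_mul_assoc)
  have K: "v \<in> ?K \<longleftrightarrow> A *v (adj B *v vfst v) + B *v vsnd v = 0 \<and> adj B *v (adj B *v vfst v) = 0" for v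
    using *[of "vfst v" "vsnd v"] by (simp only: vjoin_vfst_vsnd mem_Collect_eq)
  have lin: "Vector_Spaces.linear (*s) (*s) (vfst :: complex^('m + 'm) \<Rightarrow> _)"
    by (intro vec_linearI) simp_all
  have e1: "vfst ` ?K = ?I"
  proof (intro equalityI subsetI)
    fix w assume "w \<in> vfst ` ?K"
    then obtain v where v: "w = vfst v" "v \<in> ?K" by blast
    then have "A *v (adj B *v w) = B *v (- vsnd v)"
      by (simp only: K vec.neg) (simp add: eq_neg_iff_add_eq_0)
    then show "w \<in> ?I" using v by (simp only: K mem_Collect_eq) blast
  next
    fix w assume "w \<in> ?I"
    then obtain v where "A *v (adj B *v w) = B *v v" "adj B *v (adj B *v w) = 0" by blast
    then have "vjoin w (- v) \<in> ?K" by (simp only: K vfst_vjoin vsnd_vjoin vec.neg) simp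
    then show "w \<in> vfst ` ?K" by (intro image_eqI[of _ _ "vjoin w (- v)"]) auto
  qed
  have e2: "{v \<in> ?K. vfst v = 0} = {v. vfst v \<in> {0} \<and> vsnd v \<in> {x. B *v x = 0}}"
    by (intro Collect_cong) (auto simp only: K singleton_iff mem_Collect_eq vec.zero add_0)
  have e3: "vec.dim {v. vfst v \<in> {0} \<and> vsnd v \<in> {x. B *v x = 0}} = vec.dim {x. B *v x = 0}"
    by (subst dim_times(2)) (auto intro: subspace_kernel)
  have "vec.dim ?I + vec.dim {x. B *v x = 0} = vec.dim ?K"
    using rank_nullity[OF lin subspace_kernel[of "adj ?M"]] unfolding e1 e2 e3 .
  moreover have "rank B + vec.dim {x. B *v x = 0} = CARD('m)"
    using dim_range_add_dim_kernel[of B] dim_range_eq_rank[of B] by simp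
  ultimately show ?thesis
    using rank_add_dim_kernel_adj[of ?M] by simp
qed

section \<open>Inertia of bordered and singular Hermitian matrices\<close>

text \<open>A nonzero complex scalar multiplies the form by a positive factor, so one vector with
  positive value spans a positive complex line.\<close>

lemma form_smult: "(c *s x) \<bullet> (M *v (c *s x)) = (cmod c)\<^sup>2 * (x \<bullet> (M *v x))"
proof -
  have "Re (cnj (c * a) * (c * b)) = (cmod c)\<^sup>2 * Re (cnj a * b)" for a b
  proof -
    have "cnj (c * a) * (c * b) = (c * cnj c) * (cnj a * b)" by (simp add: mult_ac)
    also have "\<dots> = of_real ((cmod c)\<^sup>2) * (cnj a * b)" by (simp only: complex_norm_square)
    finally show ?thesis by (simp only: Re_complex_of_real times_complex.sel Im_complex_of_real mult_zero_left diff_zero)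
  qed
  then show ?thesis
    by (simp only: vec.scale inner_vec_def inner_complex_eq_Re vector_smult_component sum_distrib_left)
qed

lemma posdef_on_span_single: "0 < x \<bullet> (M *v x) \<Longrightarrow> posdef_on M (vec.span {x})"
  unfolding posdef_on_def vec.span_singleton by (auto simp: form_smult)

lemma inertia_pos_eq_0_iff:
  assumes "hermitian M"
  shows "inertia_pos M = 0 \<longleftrightarrow> (\<forall>x. x \<bullet> (M *v x) \<le> 0)"
proof
  assume 0: "inertia_pos M = 0"
  show "\<forall>x. x \<bullet> (M *v x) \<le> 0"
  proof (rule ccontr)
    assume "\<not> ?thesis"
    then obtain x where x: "0 < x \<bullet> (M *v x)" by (auto simp: not_le)
    then have "x \<noteq> 0" by auto
    then have "vec.dim (vec.span {x}) = 1" by (simp only: vec.dim_span vec.dim_singleton if_False)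
    then show False
      using inertia_pos_subspaces(2)[OF assms vec.subspace_span posdef_on_span_single[OF x]] 0 by simp
  qed
next
  assume *: "\<forall>x. x \<bullet> (M *v x) \<le> 0"
  obtain S where S: "posdef_on M S" "vec.dim S = inertia_pos M"
    using inertia_pos_subspaces(1)[OF assms] by blast
  have "S \<subseteq> {0}"
  proof
    fix x assume "x \<in> S"
    then show "x \<in> {0}"
      using S(1) * by (metis posdef_on_def not_less singletonI)
  qed
  then have "vec.dim S = 0" by (simp only: vec.dim_eq_0)
  then show "inertia_pos M = 0" using S by simp
qed

text \<open>A positive subspace meets the kernel of \<open>adj B\<close> only in zero, which bounds
  its dimension by \<open>rank B\<close>. If the bound is attained, the two subspaces are
  complementary, and the form at \<open>s + n\<close> is its value at \<open>s\<close>. Conversely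
  the range of \<open>B\<close> is a positive subspace of dimension \<open>rank B\<close>.\<close>

lemma inertia_pos_eq_rank_iff:
  fixes M :: "complex^'m^'m" and B :: "complex^'n^'m"
  assumes M: "hermitian M" and ker: "\<And>x. adj B *v x = 0 \<Longrightarrow> M *v x = 0"
  shows "inertia_pos M = rank B \<longleftrightarrow> (\<forall>y. adj B *v y \<noteq> 0 \<longrightarrow> 0 < y \<bullet> (M *v y))"
proof -
  let ?N = "{x. adj B *v x = 0}"
  have N: "vec.subspace ?N" by (rule subspace_kernel)
  have dimN: "rank B + vec.dim ?N = CARD('m)" by (rule rank_add_dim_kernel_adj)
  obtain S where S: "vec.subspace S" "posdef_on M S" "vec.dim S = inertia_pos M"
    using inertia_pos_subspaces(1)[OF M] by blast
  have SN: "S \<inter> ?N \<subseteq> {0}"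
  proof
    fix x assume x: "x \<in> S \<inter> ?N"
    then have "\<not> 0 < x \<bullet> (M *v x)" by (simp add: ker)
    then show "x \<in> {0}" using S(2) x by (auto simp: posdef_on_def)
  qed
  have le: "inertia_pos M \<le> rank B"
    using dim_Int_eq_0[OF S(1) N SN] dimN S(3) by simp
  show ?thesis
  proof
    assume eq: "inertia_pos M = rank B"
    have "vec.dim (S \<inter> ?N) = 0" using SN by (simp only: vec.dim_eq_0)
    then have "vec.dim {x + y |x y. x \<in> S \<and> y \<in> ?N} = CARD('m)"
      using vec.dim_sums_Int[OF S(1) N] eq dimN S(3) by linarith
    then have full: "{x + y |x y. x \<in> S \<and> y \<in> ?N} = UNIV"
      using vec.subspace_dim_equal[OF vec.subspace_sums[OF S(1) N] vec.subspace_UNIV subset_UNIV]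
      by (simp only: vec_dim_card order_refl simp_thms)
    show "\<forall>y. adj B *v y \<noteq> 0 \<longrightarrow> 0 < y \<bullet> (M *v y)"
    proof (intro allI impI)
      fix y assume y: "adj B *v y \<noteq> 0"
      obtain s n where sn: "y = s + n" "s \<in> S" "n \<in> ?N" using full by blast
      have "M *v n = 0" using ker sn by simp
      then have "y \<bullet> (M *v y) = s \<bullet> (M *v s)"
        using hermitian_inner[OF M, of n s] by (simp add: sn vec.add inner_add_left)
      moreover have "s \<noteq> 0" using y sn by auto
      ultimately show "0 < y \<bullet> (M *v y)" using S(2) sn by (simp add: posdef_on_def)
    qed
  next
    assume pos: "\<forall>y. adj B *v y \<noteq> 0 \<longrightarrow> 0 < y \<bullet> (M *v y)"
    have "posdef_on M (range ((*v) B))"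
      using pos range_Int_kernel_adj unfolding posdef_on_def by blast
    then have "rank B \<le> inertia_pos M"
      using inertia_pos_subspaces(2)[OF M subspace_range] dim_range_eq_rank[of B] by metis
    with le show "inertia_pos M = rank B" by simp
  qed
qed

text \<open>The constant is the minimum of the form on the compact unit sphere of
  \<open>W\<close>.\<close>

lemma posdef_on_bound:
  assumes W: "vec.subspace W" and pos: "posdef_on A W"
  obtains \<delta> where "\<delta> > 0" "\<And>x. x \<in> W \<Longrightarrow> \<delta> * (norm x)\<^sup>2 \<le> x \<bullet> (A *v x)"
proof (cases "W \<inter> sphere 0 1 = {}")
  case True
  have "x = 0" if "x \<in> W" for x
  proof (rule ccontr)
    assume "x \<noteq> 0"
    then have "(1 / norm x) *\<^sub>R x \<in> W \<inter> sphere 0 1"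
      using vec_subspace_scaleR[OF W that] by simp
    with True show False by blast
  qed
  \<comment> \<open>Here \<open>W\<close> contains no nonzero vector, so any positive constant will
    do.\<close>
  then show ?thesis by (intro that[of 1]) fastforce+
next
  case False
  have "subspace W"
    using W vec_subspace_scaleR[OF W] by (auto simp: subspace_def vec.subspace_def)
  then have "compact (W \<inter> sphere 0 1)"
    by (intro closed_Int_compact closed_subspace) auto
  then obtain x where x: "x \<in> W \<inter> sphere 0 1"
    and min: "\<And>y. y \<in> W \<inter> sphere 0 1 \<Longrightarrow> x \<bullet> (A *v x) \<le> y \<bullet> (A *v y)"
    using continuous_attains_inf[OF _ False continuous_on_form[of _ A]] by blast
  show ?thesis
  proof (rule that[of "x \<bullet> (A *v x)"])
    show "0 < x \<bullet> (A *v x)" using x pos by (auto simp: posdef_on_def)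
    fix y assume y: "y \<in> W"
    show "x \<bullet> (A *v x) * (norm y)\<^sup>2 \<le> y \<bullet> (A *v y)"
    proof (cases "y = 0")
      case False
      define z where "z = (1 / norm y) *\<^sub>R y"
      have "z \<in> W \<inter> sphere 0 1"
        using False vec_subspace_scaleR[OF W y] by (simp add: z_def)
      then have "x \<bullet> (A *v x) \<le> z \<bullet> (A *v z)" by (rule min)
      moreover have "y = norm y *\<^sub>R z" using False by (simp add: z_def)
      then have "y \<bullet> (A *v y) = (norm y)\<^sup>2 * (z \<bullet> (A *v z))"
        by (metis inner_scaleR_left inner_scaleR_right matrix_vector_scaleR mult.assoc power2_eq_square)
      ultimately show ?thesis by (simp add: mult_right_mono mult.commute)
    qed simp
  qed
qed

lemma hermitian_M1: "hermitian A \<Longrightarrow> hermitian (four_block A B (adj B) 0)"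
  by (simp add: hermitian_def adj_four_block)

lemma form_M1:
  "vjoin x y \<bullet> (four_block A B (adj B) 0 *v vjoin x y) = x \<bullet> (A *v x) + 2 * (x \<bullet> (B *v y))"
  using inner_adj[of y "adj B" x] by (simp add: four_block_mult inner_vjoin inner_add_right inner_commute)

text \<open>The vectors \<open>(w + B y, c y)\<close> with \<open>w \<in> W\<close> and \<open>y \<in> range B\<^sup>*\<close> span a positive
  subspace for large \<open>c\<close>, because \<open>w\<close> is orthogonal to \<open>B y\<close>.\<close>

lemma inertia_pos_M1_ge:
  fixes A B :: "complex^'m^'m"
  assumes A: "hermitian A" and W: "vec.subspace W" "posdef_on A W"
    and WB: "\<And>w. w \<in> W \<Longrightarrow> adj B *v w = 0"
  shows "rank B + vec.dim W \<le> inertia_pos (four_block A B (adj B) 0)"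
proof -
  let ?M = "four_block A B (adj B) 0"
  obtain \<delta> where \<delta>: "\<delta> > 0" "\<And>x. x \<in> W \<Longrightarrow> \<delta> * (norm x)\<^sup>2 \<le> x \<bullet> (A *v x)"
    using posdef_on_bound[OF W] by blast
  obtain K where K: "K > 0" "\<And>x. norm (A *v x) \<le> norm x * K"
    using bounded_linear.pos_bounded[OF matrix_vector_mul_bounded_linear[of A]] by blast
  have Kxy: "\<bar>x \<bullet> (A *v y)\<bar> \<le> K * norm x * norm y" for x y
  proof -
    have "\<bar>x \<bullet> (A *v y)\<bar> \<le> norm x * norm (A *v y)" by (rule Cauchy_Schwarz_ineq2)
    also have "\<dots> \<le> norm x * (norm y * K)" by (intro mult_left_mono K) simp
    finally show ?thesis by (simp add: mult_ac)
  qed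
  \<comment> \<open>With this \<open>c\<close>, completing the square in the lower bound for the
    form leaves exactly \<open>p\<^sup>2\<close>.\<close>
  define c where "c = (K + K\<^sup>2 / \<delta> + 1) / 2"
  have c: "c > 0" using K(1) \<delta>(1) by (simp add: c_def add_pos_nonneg)
  define L :: "complex^('m + 'm)^('m + 'm)" where "L = four_block (mat 1) B 0 (mat (of_real c))"
  have matc: "mat (of_real c) *v y = c *\<^sub>R y" for y :: "complex^'m"
    by (simp add: vec_eq_iff matrix_vector_mult_def mat_def if_distrib[of "\<lambda>c. c * _"] cong: if_cong)
      (simp add: scaleR_conv_of_real)
  have L: "L *v v = vjoin (vfst v + B *v vsnd v) (c *\<^sub>R vsnd v)" for v
    using four_block_mult[of "mat 1" B 0 "mat (of_real c)" "vfst v" "vsnd v"]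
    by (simp add: L_def matc)
  \<comment> \<open>Restricting the second component to the range of \<open>adj B\<close> makes
    \<open>B\<close> injective on it, so \<open>p = 0\<close> forces \<open>y = 0\<close>.\<close>
  define P where "P = {v. vfst v \<in> W \<and> vsnd v \<in> range ((*v) (adj B))}"
  have subP: "vec.subspace P" unfolding P_def by (intro dim_times W subspace_range)
  have dimP: "vec.dim P = rank B + vec.dim W"
    unfolding P_def by (subst dim_times) (auto simp: W subspace_range dim_range_adj_eq_rank)
  have pos: "0 < (L *v v) \<bullet> (?M *v (L *v v))" if v: "v \<in> P" "v \<noteq> 0" for v
  proof -
    define w y where "w = vfst v" and "y = vsnd v"
    have w: "w \<in> W" and y: "y \<in> range ((*v) (adj B))"
      using v by (auto simp: P_def w_def y_def)
    define n p where "n = norm w" and "p = norm (B *v y)"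
    have wB: "w \<bullet> (B *v y) = 0" using WB[OF w] by (simp add: inner_adj[of w])
    have "(L *v v) \<bullet> (?M *v (L *v v)) =
        w \<bullet> (A *v w) + 2 * (w \<bullet> (A *v (B *v y))) + (B *v y) \<bullet> (A *v (B *v y)) + 2 * c * p\<^sup>2"
      unfolding L form_M1
      using hermitian_inner_commute[OF A, of "B *v y" w]
      by (simp add: w_def[symmetric] y_def[symmetric] matrix_vector_scaleR vec.add inner_add_left
          inner_add_right wB p_def power2_norm_eq_inner)
    also have "\<dots> \<ge> \<delta> * n\<^sup>2 - 2 * (K * n * p) - K * p * p + 2 * c * p\<^sup>2"
      using \<delta>(2)[OF w] Kxy[of w "B *v y"] Kxy[of "B *v y" "B *v y"]
      unfolding n_def[symmetric] p_def[symmetric] by linarith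
    also have "\<delta> * n\<^sup>2 - 2 * (K * n * p) - K * p * p + 2 * c * p\<^sup>2 = \<delta> * (n - K * p / \<delta>)\<^sup>2 + p\<^sup>2"
      using \<delta>(1) by (simp add: c_def power2_eq_square field_simps)
    finally have ge: "\<delta> * (n - K * p / \<delta>)\<^sup>2 + p\<^sup>2 \<le> (L *v v) \<bullet> (?M *v (L *v v))" .
    have "0 < \<delta> * (n - K * p / \<delta>)\<^sup>2 + p\<^sup>2"
    proof (cases "p = 0")
      case True
      then have "y = 0" using range_Int_kernel_adj[OF y] by (simp add: p_def)
      then have "w \<noteq> 0" using v(2) by (auto simp: w_def y_def vec_join_eq_iff)
      then show ?thesis using True \<delta>(1) by (simp add: n_def)
    next
      case False
      then show ?thesis using \<delta>(1) by (intro add_nonneg_pos) auto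
    qed
    with ge show ?thesis by linarith
  qed
  \<comment> \<open>Positivity gives injectivity: the form could not be positive at a vector that
    \<open>L\<close> kills.\<close>
  have inj: "inj_on ((*v) L) P"
  proof (rule inj_onI)
    fix u v assume uv: "u \<in> P" "v \<in> P" "L *v u = L *v v"
    then have "L *v (u - v) = 0" by (simp add: vec.diff)
    then show "u = v"
      using pos[of "u - v"] vec.subspace_diff[OF subP uv(1,2)] by force
  qed
  have "posdef_on ?M ((*v) L ` P)"
    unfolding posdef_on_def
  proof safe
    fix v assume "v \<in> P" "L *v v \<noteq> 0"
    then show "0 < (L *v v) \<bullet> (?M *v (L *v v))" by (intro pos) auto
  qed
  then have "vec.dim ((*v) L ` P) \<le> inertia_pos ?M"
    by (intro inertia_pos_subspaces(2) hermitian_M1 A vec.subspace_image subP)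
  moreover have "vec.dim ((*v) L ` P) = vec.dim P"
    using inj by (intro vec.dim_image_eq) (simp_all only: vec.span_eq_iff[THEN iffD2, OF subP] matrix_vector_mul_linear_gen)
  ultimately show ?thesis using dimP by simp
qed

lemma rank_le_inertia_pos_M1:
  "hermitian A \<Longrightarrow> rank B \<le> inertia_pos (four_block A B (adj B) 0)" for A B :: "complex^'m^'m"
  using inertia_pos_M1_ge[of A "{0}" B] by (simp add: posdef_on_def)

text \<open>A vector of the kernel of \<open>adj B\<close> with positive value adds one dimension to
  the lower bound \<open>rank B\<close>. If there is none, the form of the block matrix is
  nonpositive on all vectors whose first component lies in that kernel, a subspace of codimension
  \<open>rank B\<close>.\<close>

lemma inertia_pos_M1_eq_rank_iff:
  fixes A B :: "complex^'m^'m"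
  assumes A: "hermitian A"
  shows "inertia_pos (four_block A B (adj B) 0) = rank B \<longleftrightarrow>
    (\<forall>x. adj B *v x = 0 \<longrightarrow> x \<bullet> (A *v x) \<le> 0)"
proof
  let ?M = "four_block A B (adj B) 0"
  assume eq: "inertia_pos ?M = rank B"
  show "\<forall>x. adj B *v x = 0 \<longrightarrow> x \<bullet> (A *v x) \<le> 0"
  proof (rule ccontr)
    assume "\<not> ?thesis"
    then obtain x where x: "adj B *v x = 0" "0 < x \<bullet> (A *v x)" by (auto simp: not_le)
    then have "x \<noteq> 0" by auto
    then have "vec.dim (vec.span {x}) = 1" by (simp only: vec.dim_span vec.dim_singleton if_False)
    moreover have "adj B *v w = 0" if "w \<in> vec.span {x}" for w
      using that x(1) by (auto simp: vec.span_singleton vec.scale)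
    ultimately show False
      using inertia_pos_M1_ge[OF A vec.subspace_span posdef_on_span_single[OF x(2)], of B] eq by simp
  qed
next
  let ?M = "four_block A B (adj B) 0"
  let ?T = "{v. vfst v \<in> {x. adj B *v x = 0} \<and> vsnd v \<in> UNIV} :: (complex^('m + 'm)) set"
  assume nonpos: "\<forall>x. adj B *v x = 0 \<longrightarrow> x \<bullet> (A *v x) \<le> 0"
  obtain S where S: "vec.subspace S" "posdef_on ?M S" "vec.dim S = inertia_pos ?M"
    using inertia_pos_subspaces(1)[OF hermitian_M1[OF A]] by blast
  have "S \<inter> ?T \<subseteq> {0}"
  proof
    fix v assume v: "v \<in> S \<inter> ?T"
    define x y where "x = vfst v" and "y = vsnd v"
    have "v = vjoin x y" by (simp add: x_def y_def)
    moreover have "adj B *v x = 0" using v by (simp add: x_def)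
    ultimately have "v \<bullet> (?M *v v) \<le> 0"
      using nonpos by (simp add: form_M1 inner_adj[of x B])
    then show "v \<in> {0}" using S(2) v by (force simp: posdef_on_def)
  qed
  then have "vec.dim S + vec.dim ?T \<le> CARD('m + 'm)"
    by (intro dim_Int_eq_0 S dim_times subspace_kernel vec.subspace_UNIV)
  moreover have "vec.dim ?T = vec.dim {x. adj B *v x = 0} + CARD('m)"
    by (simp only: dim_times(2)[OF subspace_kernel vec.subspace_UNIV] vec_dim_card)
  ultimately have "inertia_pos ?M \<le> rank B"
    using S(3) rank_add_dim_kernel_adj[of B] by simp
  then show "inertia_pos ?M = rank B"
    using rank_le_inertia_pos_M1[OF A, of B] by simp
qed

text \<open>If \<open>x \<noteq> 0\<close> lies in the kernel of \<open>adj B\<close> with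
  nonpositive value, the form is nonpositive on the product of its span with the whole second
  component. This has dimension \<open>CARD('m) + 1\<close>, so positive subspaces have dimension
  below \<open>CARD('m)\<close>. Conversely the entire kernel serves as \<open>W\<close> in the
  lower bound.\<close>

lemma inertia_pos_M1_ge_card_iff:
  fixes A B :: "complex^'m^'m"
  assumes A: "hermitian A"
  shows "CARD('m) \<le> inertia_pos (four_block A B (adj B) 0) \<longleftrightarrow>
    (\<forall>x. x \<noteq> 0 \<longrightarrow> adj B *v x = 0 \<longrightarrow> 0 < x \<bullet> (A *v x))"
proof
  let ?M = "four_block A B (adj B) 0"
  assume ge: "CARD('m) \<le> inertia_pos ?M"
  show "\<forall>x. x \<noteq> 0 \<longrightarrow> adj B *v x = 0 \<longrightarrow> 0 < x \<bullet> (A *v x)"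
  proof (rule ccontr)
    assume "\<not> ?thesis"
    then obtain x where x: "x \<noteq> 0" "adj B *v x = 0" "x \<bullet> (A *v x) \<le> 0" by (auto simp: not_less)
    let ?T = "{v. vfst v \<in> vec.span {x} \<and> vsnd v \<in> UNIV} :: (complex^('m + 'm)) set"
    obtain S where S: "vec.subspace S" "posdef_on ?M S" "vec.dim S = inertia_pos ?M"
      using inertia_pos_subspaces(1)[OF hermitian_M1[OF A]] by blast
    have "S \<inter> ?T \<subseteq> {0}"
    proof
      fix v assume v: "v \<in> S \<inter> ?T"
      obtain k where k: "vfst v = k *s x" using v by (auto simp: vec.span_singleton)
      have "v = vjoin (k *s x) (vsnd v)" by (metis k vjoin_vfst_vsnd)
      moreover have "adj B *v (k *s x) = 0" using x by (simp add: vec.scale)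
      ultimately have "v \<bullet> (?M *v v) = (cmod k)\<^sup>2 * (x \<bullet> (A *v x))"
        using form_M1[of "k *s x" "vsnd v" A B] by (simp add: form_smult inner_adj[of "k *s x" B])
      also have "\<dots> \<le> 0" using x by (simp add: mult_nonneg_nonpos)
      finally show "v \<in> {0}" using S(2) v by (force simp: posdef_on_def)
    qed
    then have "vec.dim S + vec.dim ?T \<le> CARD('m + 'm)"
      by (intro dim_Int_eq_0 S dim_times vec.subspace_span vec.subspace_UNIV)
    moreover have "vec.dim ?T = 1 + CARD('m)"
      using x by (simp only: dim_times(2)[OF vec.subspace_span vec.subspace_UNIV] vec_dim_card
          vec.dim_span vec.dim_singleton if_False)
    ultimately show False using S(3) ge by simp
  qed
next
  assume "\<forall>x. x \<noteq> 0 \<longrightarrow> adj B *v x = 0 \<longrightarrow> 0 < x \<bullet> (A *v x)"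
  then have "posdef_on A {x. adj B *v x = 0}" by (simp add: posdef_on_def)
  then have "rank B + vec.dim {x. adj B *v x = 0} \<le> inertia_pos (four_block A B (adj B) 0)"
    by (intro inertia_pos_M1_ge A subspace_kernel) auto
  then show "CARD('m) \<le> inertia_pos (four_block A B (adj B) 0)"
    unfolding rank_add_dim_kernel_adj .
qed

section \<open>Completion of a semidefinite form\<close>

text \<open>\<open>T\<close> is \<open>M\<close> composed with a linear right inverse of
  \<open>K\<close> on its range; by the kernel hypothesis \<open>M\<close> does not depend on the
  chosen preimage.\<close>

lemma matrix_factor_right:
  fixes K :: "'a::field^'n^'m" and M :: "'a^'n^'p"
  assumes "\<And>x. K *v x = 0 \<Longrightarrow> M *v x = 0"
  obtains T where "T ** K = M"
proof -
  obtain g where g: "Vector_Spaces.linear (*s) (*s) g" "\<And>v. v \<in> range ((*v) K) \<Longrightarrow> K *v g v = v"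
    using vec.linear_exists_right_inverse_on[OF matrix_vector_mul_linear_gen[of K] vec.subspace_UNIV] by blast
  have "M *v g (K *v x) = M *v x" for x
    using assms[of "g (K *v x) - x"] g(2) by (simp add: vec.diff)
  then have "(M ** matrix g) ** K = M"
    by (simp add: matrix_eq matrix_vector_mul_assoc[symmetric] matrix_works[OF g(1)])
  then show thesis by (rule that)
qed

text \<open>\<open>F\<close> is injective on \<open>S\<close>, so it has a linear left inverse there
  with values in \<open>S\<close>; composing this with \<open>F\<close> gives
  \<open>P\<close>.\<close>

lemma projection_along_kernel:
  fixes F :: "'a::field^'n^'m"
  assumes S: "vec.subspace S" and F: "\<And>x. x \<in> S \<Longrightarrow> F *v x = 0 \<Longrightarrow> x = 0"
  obtains P :: "'a^'n^'n" where "\<And>x. P *v x \<in> S" "\<And>x. x \<in> S \<Longrightarrow> P *v x = x"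
    "\<And>x. F *v x = 0 \<Longrightarrow> P *v x = 0"
proof -
  have "inj_on ((*v) F) S"
  proof (rule inj_onI)
    fix x y assume xy: "x \<in> S" "y \<in> S" "F *v x = F *v y"
    then show "x = y" using F[of "x - y"] vec.subspace_diff[OF S xy(1,2)] by (simp add: vec.diff)
  qed
  then obtain g where g: "range g \<subseteq> S" "Vector_Spaces.linear (*s) (*s) g" "\<And>v. v \<in> S \<Longrightarrow> g (F *v v) = v"
    using vec.linear_exists_left_inverse_on[OF matrix_vector_mul_linear_gen[of F] S] by blast
  interpret g: Vector_Spaces.linear "(*s)" "(*s)" g by (rule g)
  have P: "(matrix g ** F) *v x = g (F *v x)" for x
    by (simp add: matrix_vector_mul_assoc[symmetric] matrix_works[OF g(2)])
  show thesis
    using g(1,3) by (intro that[of "matrix g ** F"]) (auto simp: P g.zero)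
qed

lemma projection_onto:
  assumes "vec.subspace S"
  obtains P :: "'a::field^'n^'n" where "\<And>x. P *v x \<in> S" "\<And>x. x \<in> S \<Longrightarrow> P *v x = x"
  using projection_along_kernel[OF assms, of "mat 1"] by (metis matrix_vector_mul_lid)

text \<open>The four maps are projections onto \<open>R \<inter> N\<close>, onto a complement of it
  in \<open>R\<close>, onto one in \<open>N\<close>, and onto a complement of \<open>R + N\<close>.
  They let a form be prescribed block by block.\<close>

lemma decomposition_two_subspaces:
  fixes R N :: "('a::field^'n) set"
  assumes R: "vec.subspace R" and N: "vec.subspace N"
  obtains PZ PR PN PQ :: "'a^'n^'n"
  where "\<And>x. PZ *v x + PR *v x + PN *v x + PQ *v x = x"
    "\<And>x. PZ *v x \<in> R \<inter> N" "\<And>x. PR *v x \<in> R" "\<And>x. PN *v x \<in> N"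
    "\<And>x. x \<in> R \<Longrightarrow> PN *v x = 0" "\<And>x. x \<in> R \<Longrightarrow> PQ *v x = 0"
    "\<And>x. x \<in> N \<Longrightarrow> PR *v x = 0" "\<And>x. x \<in> N \<Longrightarrow> PQ *v x = 0"
proof -
  let ?M = "{x + y |x y. x \<in> R \<and> y \<in> N}"
  have Z: "vec.subspace (R \<inter> N)" by (rule vec.subspace_inter[OF R N])
  obtain gZ where gZ: "\<And>x. gZ *v x \<in> R \<inter> N" "\<And>x. x \<in> R \<inter> N \<Longrightarrow> gZ *v x = x"
    using projection_onto[OF Z] by blast
  obtain gR where gR: "\<And>x. gR *v x \<in> R" "\<And>x. x \<in> R \<Longrightarrow> gR *v x = x"
    using projection_onto[OF R] by blast
  obtain gN where gN: "\<And>x. gN *v x \<in> N" "\<And>x. x \<in> N \<Longrightarrow> gN *v x = x"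
    using projection_onto[OF N] by blast
  obtain P where P: "\<And>x. P *v x \<in> ?M" "\<And>x. x \<in> ?M \<Longrightarrow> P *v x = x"
    using projection_onto[OF vec.subspace_sums[OF R N]] by blast
  have compl: "(mat 1 - g) *v x = x - g *v x" for g :: "'a^'n^'n" and x
    by (simp add: matrix_vector_mult_diff_rdistrib)
  \<comment> \<open>The kernel of the projection \<open>gZ\<close> cuts out of \<open>R\<close> a
    complement of \<open>R \<inter> N\<close>.\<close>
  define R' where "R' = R \<inter> {x. gZ *v x = 0}"
  have s1: "vec.subspace R'"
    unfolding R'_def by (intro vec.subspace_inter R subspace_kernel)
  have k1: "x = 0" if "x \<in> R'" "(mat 1 - gN) *v x = 0" for x
  proof -
    have "gN *v x = x" using that(2) unfolding compl right_minus_eq by (rule sym)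
    then have "x \<in> R \<inter> N" using that(1) unfolding R'_def using gN(1)[of x] by simp
    then show ?thesis using that(1) gZ(2)[of x] by (simp add: R'_def)
  qed
  \<comment> \<open>The kernel of \<open>mat 1 - gN\<close> is exactly \<open>N\<close>, so
    \<open>p\<close> projects onto \<open>R'\<close> and kills \<open>N\<close>.\<close>
  obtain p where p: "\<And>x. p *v x \<in> R'"
      "\<And>x. x \<in> R' \<Longrightarrow> p *v x = x" "\<And>x. (mat 1 - gN) *v x = 0 \<Longrightarrow> p *v x = 0"
    using projection_along_kernel[of R' "mat 1 - gN"] s1 k1 by blast
  define N' where "N' = N \<inter> {x. gZ *v x = 0}"
  have s2: "vec.subspace N'"
    unfolding N'_def by (intro vec.subspace_inter N subspace_kernel)
  have k2: "x = 0" if "x \<in> N'" "(mat 1 - gR) *v x = 0" for x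
  proof -
    have "gR *v x = x" using that(2) unfolding compl right_minus_eq by (rule sym)
    then have "x \<in> R \<inter> N" using that(1) unfolding N'_def using gR(1)[of x] by simp
    then show ?thesis using that(1) gZ(2)[of x] by (simp add: N'_def)
  qed
  obtain q where q: "\<And>x. q *v x \<in> N'"
      "\<And>x. x \<in> N' \<Longrightarrow> q *v x = x" "\<And>x. (mat 1 - gR) *v x = 0 \<Longrightarrow> q *v x = 0"
    using projection_along_kernel[of N' "mat 1 - gR"] s2 k2 by blast
  have pN: "p *v x = 0" if "x \<in> N" for x using that by (intro p(3)) (simp add: compl gN)
  have qR: "q *v x = 0" if "x \<in> R" for x using that by (intro q(3)) (simp add: compl gR)
  have PR: "P *v x = x" if "x \<in> R" for x
    using P(2)[of "x + 0"] that vec.subspace_0[OF N] by (metis (mono_tags, lifting) add.right_neutral mem_Collect_eq)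
  have PN: "P *v x = x" if "x \<in> N" for x
    using P(2)[of "0 + x"] that vec.subspace_0[OF R] by (metis (mono_tags, lifting) add.left_neutral mem_Collect_eq)
  \<comment> \<open>For \<open>y = r + n\<close>, subtracting the components in \<open>R'\<close>
    and \<open>N'\<close> leaves \<open>gZ r + gZ n\<close>.\<close>
  have Z_part: "y - p *v y - q *v y \<in> R \<inter> N" if "y \<in> ?M" for y
  proof -
    obtain r n where rn: "y = r + n" "r \<in> R" "n \<in> N" using \<open>y \<in> ?M\<close> by blast
    have "p *v (r - gZ *v r) = r - gZ *v r"
      using gZ rn vec.subspace_diff[OF R] by (intro p(2)) (auto simp: vec.diff R'_def)
    then have pr: "p *v r = r - gZ *v r" using pN gZ(1)[of r] by (simp add: vec.diff)
    have "q *v (n - gZ *v n) = n - gZ *v n"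
      using gZ rn vec.subspace_diff[OF N] by (intro q(2)) (auto simp: vec.diff N'_def)
    then have qn: "q *v n = n - gZ *v n" using qR gZ(1)[of n] by (simp add: vec.diff)
    have "y - p *v y - q *v y = gZ *v r + gZ *v n"
      using pN[OF rn(3)] qR[OF rn(2)] by (simp add: rn vec.add pr qn)
    then show ?thesis using vec.subspace_add[OF Z gZ(1) gZ(1)] by simp
  qed
  show thesis
  proof (rule that[of "P - p ** P - q ** P" "p ** P" "q ** P" "mat 1 - P"])
    fix x
    show "(P - p ** P - q ** P) *v x \<in> R \<inter> N"
      using Z_part[OF P(1)[of x]]
      by (simp add: matrix_vector_mult_diff_rdistrib matrix_vector_mul_assoc[symmetric])
  qed (use p(1) q(1) pN qR PR PN in
      \<open>auto simp: R'_def N'_def matrix_vector_mult_diff_rdistrib matrix_vector_mul_assoc[symmetric]\<close>)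
qed

text \<open>\<open>E = D T\<^sup>*\<close>, where \<open>D\<close> projects onto \<open>Z\<close> and \<open>T (D\<^sup>* G D) = G D\<close>; the factor \<open>T\<close> exists
  because isotropic vectors of \<open>Z\<close> lie in the kernel of \<open>G\<close>.\<close>

lemma form_orthogonal_projection:
  fixes G :: "complex^'n^'n"
  assumes G: "hermitian G" and Z: "vec.subspace Z"
    and iso: "\<And>z. z \<in> Z \<Longrightarrow> z \<bullet> (G *v z) = 0 \<Longrightarrow> G *v z = 0"
  obtains E :: "complex^'n^'n" where "\<And>x. E *v x \<in> Z" "\<And>x z. z \<in> Z \<Longrightarrow> z \<bullet> (G *v (x - E *v x)) = 0"
proof -
  obtain D where D: "\<And>x. D *v x \<in> Z" "\<And>x. x \<in> Z \<Longrightarrow> D *v x = x"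
    using projection_onto[OF Z] by blast
  have "adj G = G" using G by (simp add: hermitian_def)
  let ?K = "adj D ** G ** D"
  have "(G ** D) *v x = 0" if "?K *v x = 0" for x
  proof -
    have "(D *v x) \<bullet> (G *v (D *v x)) = x \<bullet> (?K *v x)"
      using inner_adj[of x "adj D"] by (simp add: matrix_vector_mul_assoc[symmetric])
    then have "G *v (D *v x) = 0" using iso[OF D(1)] that by simp
    then show ?thesis by (simp add: matrix_vector_mul_assoc[symmetric])
  qed
  then obtain T where "T ** ?K = G ** D" using matrix_factor_right[of ?K "G ** D"] by blast
  \<comment> \<open>The adjoint equation states that \<open>adj D ** G\<close> annihilates
    \<open>x - D (adj T) x\<close>, which is the orthogonality sought.\<close>
  then have "adj (T ** ?K) = adj (G ** D)" by simp
  then have T: "adj D ** G ** D ** adj T = adj D ** G"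
    by (simp add: adj_mult \<open>adj G = G\<close> matrix_mul_assoc)
  show thesis
  proof (rule that[of "D ** adj T"])
    fix x z
    show "(D ** adj T) *v x \<in> Z" by (simp add: matrix_vector_mul_assoc[symmetric] D(1))
    assume z: "z \<in> Z"
    have "adj D *v (G *v (x - (D ** adj T) *v x)) = 0"
      using T by (simp add: vec.diff matrix_vector_mul_assoc matrix_mul_assoc)
    then have "(D *v z) \<bullet> (G *v (x - (D ** adj T) *v x)) = 0"
      using inner_adj[of z "adj D" "G *v (x - (D ** adj T) *v x)"] by (simp only: adj_adj inner_zero_right)
    then show "z \<bullet> (G *v (x - (D ** adj T) *v x)) = 0" by (simp add: D(2)[OF z])
  qed
qed

section \<open>Completion of the form and the homogeneous equation\<close>

lemma form_congruence: "x \<bullet> ((adj P ** M ** Q) *v y) = (P *v x) \<bullet> (M *v (Q *v y))"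
  using inner_adj[of x "adj P"] by (simp add: matrix_vector_mul_assoc[symmetric])

text \<open>The Schur complement of \<open>G\<close> with respect to \<open>Z = R \<inter> N\<close> is kept on \<open>R\<close> and on \<open>N\<close>, and the
  entries that couple complements of \<open>Z\<close> in \<open>R\<close> and in \<open>N\<close> are replaced by zero; the complement of
  \<open>R + N\<close> gets the standard form.\<close>

lemma psd_completion:
  fixes G :: "complex^'n^'n"
  assumes G: "hermitian G" and R: "vec.subspace R" and N: "vec.subspace N"
    and GR: "\<And>x. x \<in> R \<Longrightarrow> 0 \<le> x \<bullet> (G *v x)" and GN: "\<And>x. x \<in> N \<Longrightarrow> 0 \<le> x \<bullet> (G *v x)"
    and iso: "\<And>z. z \<in> R \<inter> N \<Longrightarrow> z \<bullet> (G *v z) = 0 \<Longrightarrow> G *v z = 0"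
  obtains H where "pos_semidef H"
    "posdef_on G R \<Longrightarrow> posdef_on G N \<Longrightarrow> pos_def H"
    "\<And>z. z \<in> R \<inter> N \<Longrightarrow> (G - H) *v z = 0"
    "\<And>x y. x \<in> R \<Longrightarrow> y \<in> R \<Longrightarrow> x \<bullet> ((G - H) *v y) = 0"
    "\<And>x y. x \<in> N \<Longrightarrow> y \<in> N \<Longrightarrow> x \<bullet> ((G - H) *v y) = 0"
proof -
  have Z: "vec.subspace (R \<inter> N)" by (rule vec.subspace_inter[OF R N])
  obtain PZ PR PN PQ :: "complex^'n^'n"
    where sum: "\<And>x. PZ *v x + PR *v x + PN *v x + PQ *v x = x"
    and PZ: "\<And>x. PZ *v x \<in> R \<inter> N" and PR: "\<And>x. PR *v x \<in> R" and PN: "\<And>x. PN *v x \<in> N"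
    and onR: "\<And>x. x \<in> R \<Longrightarrow> PN *v x = 0" "\<And>x. x \<in> R \<Longrightarrow> PQ *v x = 0"
    and onN: "\<And>x. x \<in> N \<Longrightarrow> PR *v x = 0" "\<And>x. x \<in> N \<Longrightarrow> PQ *v x = 0"
    using decomposition_two_subspaces[OF R N] by blast
  obtain E :: "complex^'n^'n" where E: "\<And>x. E *v x \<in> R \<inter> N"
    and orth: "\<And>x z. z \<in> R \<inter> N \<Longrightarrow> z \<bullet> (G *v (x - E *v x)) = 0"
    using form_orthogonal_projection[OF G Z iso] by blast
  have "adj G = G" using G by (simp add: hermitian_def)
  define e where "e x = x - E *v x" for x
  define F where "F = mat 1 - E"
  have F: "F *v x = e x" for x by (simp add: F_def e_def matrix_vector_mult_diff_rdistrib)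
  have e_diff: "e (x - y) = e x - e y" for x y by (simp add: e_def vec.diff)
  have eR: "e x \<in> R" if "x \<in> R" for x
    using vec.subspace_diff[OF R that] E[of x] by (simp add: e_def)
  have eN: "e x \<in> N" if "x \<in> N" for x
    using vec.subspace_diff[OF N that] E[of x] by (simp add: e_def)
  \<comment> \<open>\<open>e z\<close> lies in \<open>R \<inter> N\<close> and is
    \<open>G\<close>-orthogonal to it, hence isotropic.\<close>
  have Ge: "G *v e z = 0" if "z \<in> R \<inter> N" for z
  proof (rule iso)
    show "e z \<in> R \<inter> N" using that eR eN by blast
    then show "e z \<bullet> (G *v e z) = 0" using orth by (simp add: e_def)
  qed
  \<comment> \<open>Along \<open>x = E x + e x\<close> the form decomposes without cross terms into
    its part on \<open>R \<inter> N\<close> and the Schur complement.\<close>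
  have split: "x \<bullet> (G *v y) = (E *v x) \<bullet> (G *v (E *v y)) + e x \<bullet> (G *v e y)" for x y
  proof -
    have "x = E *v x + e x" "y = E *v y + e y" by (simp_all add: e_def)
    moreover have "(E *v x) \<bullet> (G *v e y) = 0" using orth[OF E] by (simp add: e_def)
    moreover have "e x \<bullet> (G *v (E *v y)) = 0"
      using orth[OF E] hermitian_inner_commute[OF G, of "e x"] by (simp add: e_def)
    ultimately show ?thesis
      by (metis (no_types, lifting) add.left_neutral add.right_neutral inner_add_left inner_add_right vec.add)
  qed
  define H where "H = adj E ** G ** E + adj (F ** PR) ** G ** (F ** PR) +
    adj (F ** PN) ** G ** (F ** PN) + adj PQ ** mat 1 ** PQ"
  have form: "x \<bullet> (H *v y) = (E *v x) \<bullet> (G *v (E *v y)) + e (PR *v x) \<bullet> (G *v e (PR *v y)) +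
      e (PN *v x) \<bullet> (G *v e (PN *v y)) + (PQ *v x) \<bullet> (PQ *v y)" for x y
    unfolding H_def matrix_vector_mult_add_rdistrib inner_add_right form_congruence
    by (simp add: matrix_vector_mul_assoc[symmetric] F)
  have nonneg: "0 \<le> (E *v x) \<bullet> (G *v (E *v x))" "0 \<le> e (PR *v x) \<bullet> (G *v e (PR *v x))"
    "0 \<le> e (PN *v x) \<bullet> (G *v e (PN *v x))" "0 \<le> (PQ *v x) \<bullet> (PQ *v x)" for x
    using E[of x] GR[of "E *v x"] GR[OF eR[OF PR]] GN[OF eN[OF PN]] by simp_all
  have H: "hermitian H"
    by (simp add: hermitian_def H_def adj_add adj_mult \<open>adj G = G\<close> matrix_mul_assoc)
  have diff: "x \<bullet> ((G - H) *v y) = e x \<bullet> (G *v e y) - e (PR *v x) \<bullet> (G *v e (PR *v y)) -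
      e (PN *v x) \<bullet> (G *v e (PN *v y)) - (PQ *v x) \<bullet> (PQ *v y)" for x y
    unfolding matrix_vector_mult_diff_rdistrib inner_diff_right form split[of x y] by simp
  have e0: "e 0 = 0" by (simp add: e_def)
  have reduce: "e (x - z) \<bullet> (G *v e (y - z')) = e x \<bullet> (G *v e y)"
    if "z \<in> R \<inter> N" "z' \<in> R \<inter> N" for x y z z'
    using Ge[OF that(1)] Ge[OF that(2)]
    by (simp add: e_diff vec.diff inner_diff_left hermitian_inner[OF G, of "e z"])
  show thesis
  proof (rule that[of H])
    show "pos_semidef H"
      using H nonneg by (simp add: pos_semidef_def form add_nonneg_nonneg)
    fix z assume z: "z \<in> R \<inter> N"
    have "x \<bullet> ((G - H) *v z) = 0" for x
      using z by (simp add: diff onR onN e0 Ge)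
    then show "(G - H) *v z = 0" by (metis inner_eq_zero_iff)
  next
    fix x y assume xy: "x \<in> R" "y \<in> R"
    \<comment> \<open>On \<open>R\<close> the map \<open>PR\<close> differs from the identity by an
      element of \<open>R \<inter> N\<close>, to which the Schur complement is blind. The same
      argument applies to \<open>PN\<close> on \<open>N\<close>.\<close>
    have "PR *v u = u - PZ *v u" if "u \<in> R" for u
      using sum[of u] onR[OF that] by (simp add: eq_diff_eq add.commute)
    then show "x \<bullet> ((G - H) *v y) = 0"
      using xy PZ by (simp add: diff onR e0 reduce)
  next
    fix x y assume xy: "x \<in> N" "y \<in> N"
    have "PN *v u = u - PZ *v u" if "u \<in> N" for u
      using sum[of u] onN[OF that] by (simp add: eq_diff_eq add.commute)
    then show "x \<bullet> ((G - H) *v y) = 0"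
      using xy PZ by (simp add: diff onN e0 reduce)
  next
    assume pos: "posdef_on G R" "posdef_on G N"
    show "pos_def H"
      unfolding pos_def_def
    proof (intro conjI H allI impI)
      fix x :: "complex^'n" assume "x \<noteq> 0"
      show "0 < x \<bullet> (H *v x)"
      proof (rule ccontr)
        assume "\<not> 0 < x \<bullet> (H *v x)"
        then have "(E *v x) \<bullet> (G *v (E *v x)) = 0" "e (PR *v x) \<bullet> (G *v e (PR *v x)) = 0"
          "e (PN *v x) \<bullet> (G *v e (PN *v x)) = 0" "(PQ *v x) \<bullet> (PQ *v x) = 0"
          using nonneg[of x] unfolding form by linarith+
        then have 0: "E *v x = 0" "e (PR *v x) = 0" "e (PN *v x) = 0" "PQ *v x = 0"
          using pos E[of x] eR[OF PR] eN[OF PN] unfolding posdef_on_def by (auto simp: less_le)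
        \<comment> \<open>\<open>e u = 0\<close> means \<open>u = E u\<close>, so every remaining
          component of \<open>x\<close> lies in \<open>R \<inter> N\<close>; there
          \<open>G x = G (e x) = 0\<close> contradicts positivity.\<close>
        then have "PR *v x \<in> R \<inter> N" "PN *v x \<in> R \<inter> N"
          using E[of "PR *v x"] E[of "PN *v x"] by (simp_all add: e_def)
        then have "x \<in> R \<inter> N"
          using sum[of x] PZ[of x] 0(4) vec.subspace_add[OF Z] by (metis add.right_neutral)
        then have "G *v x = 0" using Ge[of x] 0(1) by (simp add: e_def)
        then show False
          using pos(1) \<open>x \<in> R \<inter> N\<close> \<open>x \<noteq> 0\<close> by (auto simp: posdef_on_def)
      qed
    qed
  qed
qed

text \<open>\<open>W = U + adj U\<close>, where \<open>B ** U = 0\<close> and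
  \<open>U ** adj B = Y\<close> with \<open>Y + adj Y = L\<close>. Then \<open>B ** W\<close> is
  \<open>adj Y\<close>, \<open>W ** adj B\<close> is \<open>Y\<close>, and
  \<open>B ** W ** adj B\<close> vanishes.\<close>

lemma homogeneous_solution:
  fixes B L :: "complex^'n^'n"
  defines "R \<equiv> range ((*v) (adj B))" and "N \<equiv> {x. adj B *v x = 0}"
  assumes L: "hermitian L"
    and LZ: "\<And>z. z \<in> R \<inter> N \<Longrightarrow> L *v z = 0"
    and LR: "\<And>x y. x \<in> R \<Longrightarrow> y \<in> R \<Longrightarrow> x \<bullet> (L *v y) = 0"
    and LN: "\<And>x y. x \<in> N \<Longrightarrow> y \<in> N \<Longrightarrow> x \<bullet> (L *v y) = 0"
  obtains W where "hermitian W" "B ** W + W ** adj B = L" "B ** W ** adj B = 0"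
proof -
  have R: "vec.subspace R" and N: "vec.subspace N"
    by (simp_all add: R_def N_def subspace_range subspace_kernel)
  obtain PZ PR PN PQ :: "complex^'n^'n"
    where sum: "\<And>x. PZ *v x + PR *v x + PN *v x + PQ *v x = x"
    and PZ: "\<And>x. PZ *v x \<in> R \<inter> N" and PR: "\<And>x. PR *v x \<in> R" and PN: "\<And>x. PN *v x \<in> N"
    and onR: "\<And>x. x \<in> R \<Longrightarrow> PN *v x = 0" "\<And>x. x \<in> R \<Longrightarrow> PQ *v x = 0"
    and onN: "\<And>x. x \<in> N \<Longrightarrow> PR *v x = 0" "\<And>x. x \<in> N \<Longrightarrow> PQ *v x = 0"
    using decomposition_two_subspaces[OF R N] by blast
  have "(PR + PQ) *v x = 0" if "adj B *v x = 0" for x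
    using that onN by (simp add: N_def matrix_vector_mult_add_rdistrib)
  then obtain T where T: "T ** adj B = PR + PQ"
    using matrix_factor_right[of "adj B" "PR + PQ"] by blast
  have "(PN + PQ) ** adj B = 0" and PQB: "PQ ** adj B = 0"
    using onR by (auto simp: matrix_eq matrix_vector_mul_assoc[symmetric] R_def matrix_vector_mult_add_rdistrib)
  then have B0: "B ** adj (PN + PQ) = 0" "B ** adj PQ = 0"
    using adj_mult[of "PN + PQ" "adj B"] adj_mult[of PQ "adj B"] by simp_all
  obtain T' where T': "T' ** adj B = PQ"
    using matrix_factor_right[of "adj B" PQ] onN by (auto simp: N_def)
  define L' where "L' = (1 / 2) *\<^sub>R L"
  have "adj L' = L'" using L by (simp add: L'_def adj_scaleR hermitian_def)
  have L': "L' *v x = (1 / 2) *\<^sub>R (L *v x)" for x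
    by (simp add: L'_def vec_eq_iff matrix_vector_mult_def scaleR_sum_right)
  define U where "U = adj (PN + PQ) ** L ** T - adj PQ ** L' ** T'"
  \<comment> \<open>\<open>Y\<close> collects one of each pair of adjoint blocks of \<open>L\<close>
    that can be nonzero. The block of \<open>PQ\<close> with itself is its own partner, so only half
    of it is kept.\<close>
  define Y where "Y = adj (PN + PQ) ** L ** (PR + PQ) - adj PQ ** L' ** PQ"
  have BU: "B ** U = 0"
    by (simp add: U_def matrix_diff_ldistrib matrix_mul_assoc B0)
  have UB: "U ** adj B = Y"
    by (simp add: U_def Y_def matrix_diff_rdistrib matrix_mul_assoc[symmetric] T T')
  have BU': "B ** adj U = adj Y" and UB': "adj U ** adj B = 0"
    using adj_mult[of U "adj B"] adj_mult[of B U] by (simp_all add: UB BU)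
  have "L = adj Y + Y"
  proof -
    have "x \<bullet> ((adj Y + Y - L) *v y) = 0" for x y
    proof -
      have Y: "u \<bullet> (Y *v v) = (PN *v u + PQ *v u) \<bullet> (L *v (PR *v v + PQ *v v))
          - (1 / 2) * ((PQ *v u) \<bullet> (L *v (PQ *v v)))" for u v
        unfolding Y_def matrix_vector_mult_diff_rdistrib inner_diff_right form_congruence
        by (simp add: matrix_vector_mult_add_rdistrib L')
      have LZ': "u \<bullet> (L *v (PZ *v v)) = 0" "(PZ *v v) \<bullet> (L *v u) = 0" for u v
        using LZ[OF PZ] hermitian_inner[OF L] by simp_all
      have "x \<bullet> (L *v y) = (PZ *v x + PR *v x + PN *v x + PQ *v x) \<bullet>
          (L *v (PZ *v y + PR *v y + PN *v y + PQ *v y))"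
        by (simp only: sum)
      also have "\<dots> = x \<bullet> (Y *v y) + y \<bullet> (Y *v x)"
        unfolding Y vec.add inner_add_left inner_add_right LZ'
          hermitian_inner_commute[OF L, of "PN *v y"] hermitian_inner_commute[OF L, of "PQ *v y"]
        by (simp add: LR PR LN PN)
      finally show ?thesis
        using inner_adj[of x "adj Y" y]
        by (simp add: matrix_vector_mult_diff_rdistrib matrix_vector_mult_add_rdistrib
            inner_diff_right inner_add_right inner_commute)
    qed
    then show ?thesis using matrix_eq_0_if_form_eq_0 by fastforce
  qed
  then have "B ** (U + adj U) + (U + adj U) ** adj B = L"
    by (simp add: matrix_add_ldistrib matrix_add_rdistrib BU UB BU' UB')
  moreover have "B ** (U + adj U) ** adj B = 0"
    by (simp add: matrix_add_rdistrib UB UB' BU flip: matrix_mul_assoc)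
      (simp add: BU flip: UB add: matrix_mul_assoc)
  moreover have "hermitian (U + adj U)" by (simp add: hermitian_def adj_add add.commute)
  ultimately show thesis using that by blast
qed

section \<open>Solvability\<close>

lemma hermitian_lyapunov: "hermitian X \<Longrightarrow> hermitian (B ** X + X ** adj B)"
  by (simp add: hermitian_def adj_add adj_mult add.commute)

lemma hermitian_diff: "hermitian M \<Longrightarrow> hermitian N \<Longrightarrow> hermitian (M - N)"
  by (simp add: hermitian_def adj_diff)

lemma hermitian_minus_iff: "hermitian (- M) \<longleftrightarrow> hermitian M"
  by (simp add: hermitian_def adj_minus)

text \<open>As \<open>C\<close> is Hermitian, the adjoint of a solution is a solution, and so is the
  average of the two.\<close>

lemma hermitian_solution:
  assumes "hermitian C" "B ** X ** adj B = C"
  obtains X' where "hermitian X'" "B ** X' ** adj B = C"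
proof
  define X' where "X' = (1 / 2) *\<^sub>R (X + adj X)"
  show "hermitian X'" by (simp add: X'_def hermitian_def adj_scaleR adj_add add.commute)
  have "B ** adj X ** adj B = C"
    using assms by (metis adj_adj adj_mult hermitian_def matrix_mul_assoc)
  then have "B ** (X + adj X) ** adj B = C + C"
    using assms(2) by (simp add: matrix_add_ldistrib matrix_add_rdistrib)
  moreover have "B ** X' ** adj B = (1 / 2) *\<^sub>R (B ** (X + adj X) ** adj B)"
    by (simp add: X'_def scalar_matrix_assoc[symmetric] matrix_scalar_ac)
  ultimately show "B ** X' ** adj B = C" by (simp add: scaleR_2[symmetric])
qed

text \<open>On the kernel of \<open>adj B\<close>, on its range and on their intersection, the
  residual \<open>H\<close> is determined by \<open>A\<close>, \<open>B\<close> and \<open>C\<close>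
  alone. The last identity expresses \<open>H\<close>-orthogonality of \<open>B\<^sup>* w\<close> to
  the range of \<open>B\<^sup>*\<close> as \<open>B (A B\<^sup>* w - C w) = 0\<close>.\<close>

lemma
  fixes A B C X :: "complex^'n^'n"
  defines "H \<equiv> A - (B ** X + X ** adj B)"
  assumes C: "B ** X ** adj B = C"
  shows residual_on_kernel: "adj B *v x = 0 \<Longrightarrow> x \<bullet> (H *v x) = x \<bullet> (A *v x)"
    and residual_on_range: "(adj B *v y) \<bullet> (H *v (adj B *v y)) =
      y \<bullet> ((B ** A ** adj B - B ** C - C ** adj B) *v y)"
    and residual_on_range_Int_kernel: "adj B *v (adj B *v w) = 0 \<Longrightarrow>
      H *v (adj B *v w) = A *v (adj B *v w) - C *v w"
    and residual_image: "adj B *v (adj B *v w) = 0 \<Longrightarrow>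
      y \<bullet> (B *v (A *v (adj B *v w) - C *v w)) = (adj B *v y) \<bullet> (H *v (adj B *v w))"
proof -
  have H: "H *v x = A *v x - (B *v (X *v x) + X *v (adj B *v x))" for x
    by (simp add: H_def matrix_vector_mult_diff_rdistrib matrix_vector_mult_add_rdistrib
        matrix_vector_mul_assoc)
  have C': "C *v x = B *v (X *v (adj B *v x))" for x
    by (simp add: C[symmetric] matrix_vector_mul_assoc matrix_mul_assoc)
  show "adj B *v x = 0 \<Longrightarrow> x \<bullet> (H *v x) = x \<bullet> (A *v x)"
    by (simp add: H inner_diff_right inner_add_right inner_adj[of x B])
  have "B ** H ** adj B = B ** A ** adj B - B ** C - C ** adj B"
    by (simp add: H_def C[symmetric] matrix_diff_ldistrib matrix_diff_rdistrib matrix_add_ldistrib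
        matrix_add_rdistrib matrix_mul_assoc)
  then show "(adj B *v y) \<bullet> (H *v (adj B *v y)) = y \<bullet> ((B ** A ** adj B - B ** C - C ** adj B) *v y)"
    using form_congruence[of y "adj B" H "adj B" y] by simp
  show Hw: "H *v (adj B *v w) = A *v (adj B *v w) - C *v w" if "adj B *v (adj B *v w) = 0"
    using that by (simp add: H C')
  then show "y \<bullet> (B *v (A *v (adj B *v w) - C *v w)) = (adj B *v y) \<bullet> (H *v (adj B *v w))"
    if "adj B *v (adj B *v w) = 0"
    using that inner_adj[of y B] by simp
qed

text \<open>The residual \<open>G = A - B X\<^sub>0 - X\<^sub>0 B\<^sup>*\<close> of one solution \<open>X\<^sub>0\<close> can be replaced by any \<open>H\<close> such
  that \<open>G - H\<close> is \<open>B W + W B\<^sup>*\<close> with \<open>B W B\<^sup>* = 0\<close>.\<close>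

lemma residual_completion:
  fixes A B C :: "complex^'n^'n"
  assumes A: "hermitian A" and X0: "hermitian X0" "B ** X0 ** adj B = C"
    and ker: "\<And>x. adj B *v x = 0 \<Longrightarrow> 0 \<le> x \<bullet> (A *v x)"
    and M3: "\<And>y. 0 \<le> y \<bullet> ((B ** A ** adj B - B ** C - C ** adj B) *v y)"
    and iso: "\<And>w. adj B *v (adj B *v w) = 0 \<Longrightarrow>
      (adj B *v w) \<bullet> ((A - (B ** X0 + X0 ** adj B)) *v (adj B *v w)) = 0 \<Longrightarrow>
      (A - (B ** X0 + X0 ** adj B)) *v (adj B *v w) = 0"
  obtains X where "hermitian X" "B ** X ** adj B = C" "pos_semidef (A - (B ** X + X ** adj B))"
    "(\<And>x. adj B *v x = 0 \<Longrightarrow> x \<noteq> 0 \<Longrightarrow> 0 < x \<bullet> (A *v x)) \<Longrightarrow>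
     (\<And>y. adj B *v y \<noteq> 0 \<Longrightarrow> 0 < y \<bullet> ((B ** A ** adj B - B ** C - C ** adj B) *v y)) \<Longrightarrow>
     pos_def (A - (B ** X + X ** adj B))"
proof -
  define G where "G = A - (B ** X0 + X0 ** adj B)"
  define R N where "R = range ((*v) (adj B))" and "N = {x. adj B *v x = 0}"
  have G: "hermitian G"
    unfolding G_def by (intro hermitian_diff A hermitian_lyapunov X0)
  have R: "vec.subspace R" and N: "vec.subspace N"
    by (simp_all add: R_def N_def subspace_range subspace_kernel)
  have GR: "(adj B *v y) \<bullet> (G *v (adj B *v y)) = y \<bullet> ((B ** A ** adj B - B ** C - C ** adj B) *v y)" for y
    unfolding G_def by (rule residual_on_range[OF X0(2)])
  have GN: "x \<bullet> (G *v x) = x \<bullet> (A *v x)" if "x \<in> N" for x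
    using that residual_on_kernel[OF X0(2), of x A] by (simp add: G_def N_def)
  have GR0: "0 \<le> x \<bullet> (G *v x)" if x: "x \<in> R" for x
  proof -
    obtain y where "x = adj B *v y" using x unfolding R_def by blast
    then show ?thesis using GR M3 by simp
  qed
  have GN0: "0 \<le> x \<bullet> (G *v x)" if "x \<in> N" for x
    using GN[OF that] that ker by (simp add: N_def)
  have Giso: "G *v z = 0" if z: "z \<in> R \<inter> N" "z \<bullet> (G *v z) = 0" for z
  proof -
    obtain w where "z = adj B *v w" using z(1) unfolding R_def by blast
    then show ?thesis using iso[of w] z unfolding G_def N_def by simp
  qed
  obtain H where H: "pos_semidef H" "posdef_on G R \<Longrightarrow> posdef_on G N \<Longrightarrow> pos_def H"
    "\<And>z. z \<in> R \<inter> N \<Longrightarrow> (G - H) *v z = 0"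
    "\<And>x y. x \<in> R \<Longrightarrow> y \<in> R \<Longrightarrow> x \<bullet> ((G - H) *v y) = 0"
    "\<And>x y. x \<in> N \<Longrightarrow> y \<in> N \<Longrightarrow> x \<bullet> ((G - H) *v y) = 0"
    by (rule psd_completion[OF G R N GR0 GN0 Giso]) blast+
  have "hermitian (G - H)"
    using H(1) G by (intro hermitian_diff) (simp_all add: pos_semidef_def)
  then obtain W where W: "hermitian W" "B ** W + W ** adj B = G - H" "B ** W ** adj B = 0"
    using homogeneous_solution[of "G - H" B] H(3-5) unfolding R_def N_def by blast
  have res: "A - (B ** (X0 + W) + (X0 + W) ** adj B) = H"
  proof -
    have "A - (B ** (X0 + W) + (X0 + W) ** adj B) = G - (B ** W + W ** adj B)"
      by (simp add: G_def matrix_add_ldistrib matrix_add_rdistrib)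
    then show ?thesis by (simp add: W)
  qed
  show thesis
  proof (rule that[of "X0 + W"])
    show "hermitian (X0 + W)" using X0 W by (simp add: hermitian_def adj_add)
    show "B ** (X0 + W) ** adj B = C"
      by (simp add: matrix_add_ldistrib matrix_add_rdistrib X0 W)
    show "pos_semidef (A - (B ** (X0 + W) + (X0 + W) ** adj B))"
      unfolding res by (rule H)
    assume kpos: "\<And>x. adj B *v x = 0 \<Longrightarrow> x \<noteq> 0 \<Longrightarrow> 0 < x \<bullet> (A *v x)"
      and rpos: "\<And>y. adj B *v y \<noteq> 0 \<Longrightarrow> 0 < y \<bullet> ((B ** A ** adj B - B ** C - C ** adj B) *v y)"
    show "pos_def (A - (B ** (X0 + W) + (X0 + W) ** adj B))"
      unfolding res
    proof (rule H)
      show "posdef_on G R"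
        unfolding posdef_on_def R_def using rpos by (auto simp: GR)
      show "posdef_on G N"
        unfolding posdef_on_def using kpos GN by (auto simp: N_def)
    qed
  qed
qed

section \<open>Solvability in terms of quadratic forms\<close>

text \<open>The last two conditions put isotropic vectors \<open>z = B\<^sup>* w\<close> with
  \<open>B\<^sup>* z = 0\<close> into the kernel of the residual. In the first of them,
  \<open>A z = B v\<close> makes \<open>z\<close> isotropic because \<open>z\<close> is orthogonal
  to the range of \<open>B\<close>. In the second, \<open>z\<close> is orthogonal for the residual
  to the range of \<open>B\<^sup>*\<close>, to which it belongs.\<close>

lemma solvable_le_iff:
  fixes A B C :: "complex^'n^'n"
  assumes A: "hermitian A" and X0: "hermitian X0" "B ** X0 ** adj B = C"
  shows "(\<exists>X. hermitian X \<and> B ** X + X ** adj B \<preceq>\<^sub>L A \<and> B ** X ** adj B = C) \<longleftrightarrow>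
    (\<forall>x. adj B *v x = 0 \<longrightarrow> 0 \<le> x \<bullet> (A *v x)) \<and>
    (\<forall>y. 0 \<le> y \<bullet> ((B ** A ** adj B - B ** C - C ** adj B) *v y)) \<and>
    (\<forall>w. adj B *v (adj B *v w) = 0 \<longrightarrow> A *v (adj B *v w) \<in> range ((*v) B) \<longrightarrow>
      A *v (adj B *v w) = C *v w) \<and>
    (\<forall>w. adj B *v (adj B *v w) = 0 \<longrightarrow> B *v (A *v (adj B *v w) - C *v w) = 0 \<longrightarrow>
      A *v (adj B *v w) = C *v w)"
    (is "?L \<longleftrightarrow> ?K \<and> ?M \<and> ?I \<and> ?J")
proof
  assume ?L
  then obtain X where X: "hermitian X" "B ** X ** adj B = C"
    and psd: "pos_semidef (A - (B ** X + X ** adj B))"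
    by (auto simp: loewner_le_def)
  define H where "H = A - (B ** X + X ** adj B)"
  have H: "hermitian H" "\<And>x. 0 \<le> x \<bullet> (H *v x)"
    using psd by (simp_all add: pos_semidef_def H_def)
  note on_kernel = residual_on_kernel[OF X(2), of _ A, folded H_def]
    and on_range = residual_on_range[OF X(2), of _ A, folded H_def]
    and on_Int = residual_on_range_Int_kernel[OF X(2), of _ A, folded H_def]
    and image = residual_image[OF X(2), of _ _ A, folded H_def]
  have ?K using H(2) on_kernel by metis
  moreover have ?M using H(2) on_range by metis
  moreover have ?I
  proof (intro allI impI)
    fix w assume w: "adj B *v (adj B *v w) = 0" "A *v (adj B *v w) \<in> range ((*v) B)"
    then obtain v where v: "A *v (adj B *v w) = B *v v" by blast
    have "(adj B *v w) \<bullet> (H *v (adj B *v w)) = (adj B *v w) \<bullet> (B *v v)"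
      using on_kernel[OF w(1)] v by simp
    also have "\<dots> = 0" using w(1) inner_adj[of "adj B *v w" B v] by simp
    finally have "H *v (adj B *v w) = 0" by (rule isotropic_kernel[OF H])
    then show "A *v (adj B *v w) = C *v w" using on_Int[OF w(1)] by simp
  qed
  moreover have ?J
  proof (intro allI impI)
    fix w assume w: "adj B *v (adj B *v w) = 0" "B *v (A *v (adj B *v w) - C *v w) = 0"
    have "(adj B *v w) \<bullet> (H *v (adj B *v w)) = 0"
      using image[OF w(1), of w] w(2) by simp
    then have "H *v (adj B *v w) = 0" by (rule isotropic_kernel[OF H])
    then show "A *v (adj B *v w) = C *v w" using on_Int[OF w(1)] by simp
  qed
  ultimately show "?K \<and> ?M \<and> ?I \<and> ?J" by blast
next
  assume R: "?K \<and> ?M \<and> ?I \<and> ?J"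
  define G where "G = A - (B ** X0 + X0 ** adj B)"
  have G: "hermitian G"
    unfolding G_def by (intro hermitian_diff A hermitian_lyapunov X0)
  have iso: "G *v (adj B *v w) = 0"
    if w: "adj B *v (adj B *v w) = 0" "(adj B *v w) \<bullet> (G *v (adj B *v w)) = 0" for w
  proof -
    have nonneg: "0 \<le> x \<bullet> (G *v x)" if "x \<in> range ((*v) (adj B))" for x
      using that residual_on_range[OF X0(2), of _ A] R unfolding G_def by auto
    \<comment> \<open>Nonnegativity on the range of \<open>B\<^sup>*\<close> upgrades isotropy to
      \<open>G\<close>-orthogonality to that whole range, the premise of the fourth
      condition.\<close>
    have orth: "(adj B *v y) \<bullet> (G *v (adj B *v w)) = 0" for y
      by (rule isotropic_orthogonal[OF G subspace_range[of "adj B"] _ _ w(2)], erule nonneg) (rule rangeI)+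
    have "y \<bullet> (B *v (A *v (adj B *v w) - C *v w)) = 0" for y
      using residual_image[OF X0(2) w(1), of y A] orth[of y] unfolding G_def by simp
    then have "B *v (A *v (adj B *v w) - C *v w) = 0" by (metis inner_eq_zero_iff)
    then have "A *v (adj B *v w) = C *v w" using R w(1) by blast
    then show ?thesis
      using residual_on_range_Int_kernel[OF X0(2) w(1), of A] by (simp add: G_def)
  qed
  have k: "0 \<le> x \<bullet> (A *v x)" if "adj B *v x = 0" for x using R that by blast
  have m: "0 \<le> y \<bullet> ((B ** A ** adj B - B ** C - C ** adj B) *v y)" for y using R by blast
  obtain X where "hermitian X" "B ** X ** adj B = C" "pos_semidef (A - (B ** X + X ** adj B))"
    using residual_completion[OF A X0 k m iso[unfolded G_def]] by blast
  then show ?L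
    using A hermitian_lyapunov unfolding loewner_le_def by blast
qed

text \<open>By strict positivity on the kernel of \<open>adj B\<close>, an isotropic vector of range
  and kernel is zero, which supplies the kernel condition of the completion.\<close>

lemma solvable_less_iff:
  fixes A B C :: "complex^'n^'n"
  assumes A: "hermitian A" and X0: "hermitian X0" "B ** X0 ** adj B = C"
  shows "(\<exists>X. hermitian X \<and> B ** X + X ** adj B \<prec>\<^sub>L A \<and> B ** X ** adj B = C) \<longleftrightarrow>
    (\<forall>x. x \<noteq> 0 \<longrightarrow> adj B *v x = 0 \<longrightarrow> 0 < x \<bullet> (A *v x)) \<and>
    (\<forall>y. adj B *v y \<noteq> 0 \<longrightarrow> 0 < y \<bullet> ((B ** A ** adj B - B ** C - C ** adj B) *v y))"
    (is "?L \<longleftrightarrow> ?K \<and> ?M")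
proof
  assume ?L
  then obtain X where X: "hermitian X" "B ** X ** adj B = C"
    and pd: "pos_def (A - (B ** X + X ** adj B))"
    by (auto simp: loewner_less_def)
  define H where "H = A - (B ** X + X ** adj B)"
  have H: "0 < x \<bullet> (H *v x)" if "x \<noteq> 0" for x
    using pd that by (simp add: pos_def_def H_def)
  note on_kernel = residual_on_kernel[OF X(2), of _ A, folded H_def]
    and on_range = residual_on_range[OF X(2), of _ A, folded H_def]
  have ?K using H on_kernel by metis
  moreover have ?M using H on_range by metis
  ultimately show "?K \<and> ?M" by blast
next
  assume R: "?K \<and> ?M"
  define G where "G = A - (B ** X0 + X0 ** adj B)"
  have k: "0 \<le> x \<bullet> (A *v x)" if "adj B *v x = 0" for x
    using R that by (cases "x = 0") (auto simp: less_imp_le)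
  have m: "0 \<le> y \<bullet> ((B ** A ** adj B - B ** C - C ** adj B) *v y)" for y
  proof (cases "adj B *v y = 0")
    case True
    then show ?thesis using residual_on_range[OF X0(2), of y A] by simp
  qed (use R in \<open>auto simp: less_imp_le\<close>)
  have iso: "G *v (adj B *v w) = 0"
    if w: "adj B *v (adj B *v w) = 0" "(adj B *v w) \<bullet> (G *v (adj B *v w)) = 0" for w
  proof -
    have "(adj B *v w) \<bullet> (A *v (adj B *v w)) = 0"
      using residual_on_kernel[OF X0(2) w(1), of A] w(2) by (simp add: G_def)
    then have "adj B *v w = 0" using R w(1) by force
    then show ?thesis by simp
  qed
  have k': "0 < x \<bullet> (A *v x)" if "adj B *v x = 0" "x \<noteq> 0" for x using R that by blast
  have m': "0 < y \<bullet> ((B ** A ** adj B - B ** C - C ** adj B) *v y)" if "adj B *v y \<noteq> 0" for y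
    using R that by blast
  obtain X where "hermitian X" "B ** X ** adj B = C" "pos_def (A - (B ** X + X ** adj B))"
    using residual_completion[OF A X0 k m iso[unfolded G_def]] k' m' by metis
  then show ?L
    using A hermitian_lyapunov unfolding loewner_less_def by blast
qed

section \<open>Translation into ranks and inertia\<close>

lemma rank_minus: "rank (- B) = rank B" for B :: "complex^'n^'m"
  using rank_add_dim_kernel_adj[of "- B"] rank_add_dim_kernel_adj[of B]
  by (simp add: adj_minus matrix_vector_minus_left)

lemma inertia_neg_M1:
  fixes A B :: "complex^'m^'m"
  assumes "hermitian A"
  shows "inertia_neg (four_block A B (adj B) 0) =
    inertia_pos (four_block (- A) (- B) (adj (- B)) 0)"
  using inertia_pos_minus[OF hermitian_M1[OF assms], of B] by (simp add: four_block_minus adj_minus)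

lemma rank_le_inertia_neg_M1:
  fixes A B :: "complex^'m^'m"
  assumes "hermitian A"
  shows "rank B \<le> inertia_neg (four_block A B (adj B) 0)"
  using rank_le_inertia_pos_M1[of "- A" "- B"] assms
  by (simp add: inertia_neg_M1 hermitian_minus_iff rank_minus)

lemma inertia_neg_M1_eq_rank_iff:
  fixes A B :: "complex^'m^'m"
  assumes "hermitian A"
  shows "inertia_neg (four_block A B (adj B) 0) = rank B \<longleftrightarrow>
    (\<forall>x. adj B *v x = 0 \<longrightarrow> 0 \<le> x \<bullet> (A *v x))"
  using inertia_pos_M1_eq_rank_iff[of "- A" "- B"] assms
  by (simp add: inertia_neg_M1 hermitian_minus_iff rank_minus adj_minus matrix_vector_minus_left)

lemma inertia_neg_eq_0_iff:
  assumes "hermitian M"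
  shows "inertia_neg M = 0 \<longleftrightarrow> (\<forall>x. 0 \<le> x \<bullet> (M *v x))"
  using inertia_pos_eq_0_iff[of "- M"] assms
  by (simp add: inertia_pos_minus hermitian_minus_iff matrix_vector_minus_left)

lemma hermitian_M3:
  "hermitian A \<Longrightarrow> hermitian C \<Longrightarrow> hermitian (B ** A ** adj B - B ** C - C ** adj B)"
  by (simp add: hermitian_def adj_diff adj_mult matrix_mul_assoc diff_right_commute)

lemma rank_M3_block:
  fixes A B C :: "complex^'n^'n"
  assumes "hermitian A" "hermitian C"
  shows "rank (row_block (B ** B) (C ** adj B - B ** A ** adj B)) +
    vec.dim {w. adj B *v (adj B *v w) = 0 \<and> B *v (A *v (adj B *v w) - C *v w) = 0} = CARD('n)"
proof -
  have "adj (C ** adj B - B ** A ** adj B) *v w = - (B *v (A *v (adj B *v w) - C *v w))" for w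
    using assms by (simp add: adj_diff adj_mult hermitian_def matrix_vector_mult_diff_rdistrib
        matrix_vector_mul_assoc matrix_mul_assoc vec.diff)
  then show ?thesis
    using rank_row_block[of "B ** B" "C ** adj B - B ** A ** adj B"]
    by (simp add: adj_mult matrix_vector_mul_assoc[symmetric])
qed

text \<open>In terms of dimensions the two equations read
  \<open>(?n1 - rank B) + (dim I - dim K) = 0\<close> and \<open>?n3 + (dim J - dim K) = 0\<close>.
  All four summands are nonnegative, so each vanishes; they match the four conditions of
  \<open>solvable_le_iff\<close>.\<close>

lemma corollary_le:
  fixes A B C :: "complex^'m^'m"
  assumes A: "hermitian A" and C: "hermitian C" and X: "\<exists>X. B ** X ** adj B = C"
  shows "(\<exists>X. hermitian X \<and> B ** X + X ** adj B \<preceq>\<^sub>L A \<and> B ** X ** adj B = C) \<longleftrightarrow>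
    rank (row_block (B ** B) (C - B ** A)) + inertia_neg (four_block A B (adj B) 0) =
      rank (four_block (B ** A) (B ** B) (adj B) 0) \<and>
    rank (row_block (B ** B) (C - B ** A)) + inertia_neg (B ** A ** adj B - B ** C - C ** adj B) =
      rank (row_block (B ** B) (C ** adj B - B ** A ** adj B))"
    (is "_ \<longleftrightarrow> ?r0 + ?n1 = ?r1 \<and> ?r0 + ?n3 = ?r2")
proof -
  obtain X0 where X0: "hermitian X0" "B ** X0 ** adj B = C"
    using X hermitian_solution[OF C] by blast
  define I K J where "I = {w. adj B *v (adj B *v w) = 0 \<and> A *v (adj B *v w) \<in> range ((*v) B)}"
    and "K = {w. adj B *v (adj B *v w) = 0 \<and> A *v (adj B *v w) = C *v w}"
    and "J = {w. adj B *v (adj B *v w) = 0 \<and> B *v (A *v (adj B *v w) - C *v w) = 0}"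
  have adjA: "adj A = A" and adjC: "adj C = C" using A C by (simp_all add: hermitian_def)
  \<comment> \<open>Consistency puts the range of \<open>C\<close> inside that of \<open>B\<close>,
    whence \<open>K \<subseteq> I\<close>.\<close>
  have Crange: "C *v w \<in> range ((*v) B)" for w
    by (simp add: X0(2)[symmetric] flip: matrix_vector_mul_assoc matrix_mul_assoc)
  have sub: "K \<subseteq> I" "K \<subseteq> J"
    using Crange by (auto simp: K_def I_def J_def)
  have K: "vec.subspace K" and J: "vec.subspace J"
    by (auto simp: K_def J_def vec.subspace_def vec.add vec.scale vec.diff)
  have I: "vec.subspace I"
  proof -
    have "vec.subspace {w. adj B *v (adj B *v w) = 0 \<and> A *v (adj B *v w) \<in> S}"
      if "vec.subspace S" for S
      using that by (auto simp: vec.subspace_def vec.add vec.scale)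
    then show ?thesis unfolding I_def using subspace_range by blast
  qed
  have "?r0 + vec.dim K = CARD('m)"
  proof -
    have "adj (C - B ** A) *v w = 0 \<longleftrightarrow> A *v (adj B *v w) = C *v w" for w
      by (auto simp: adj_diff adj_mult adjA adjC matrix_vector_mult_diff_rdistrib matrix_vector_mul_assoc)
    then show ?thesis
      using rank_row_block[of "B ** B" "C - B ** A"]
      by (simp add: K_def adj_mult matrix_vector_mul_assoc[symmetric])
  qed
  moreover have "?r1 + vec.dim I = rank B + CARD('m)"
    unfolding I_def by (rule rank_M2[OF A])
  moreover have "?r2 + vec.dim J = CARD('m)"
    unfolding J_def by (rule rank_M3_block[OF A C])
  moreover have "rank B \<le> ?n1" by (rule rank_le_inertia_neg_M1[OF A])
  moreover have "vec.dim K \<le> vec.dim I" "vec.dim K \<le> vec.dim J"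
    using sub by (auto intro: vec.dim_subset)
  moreover have "vec.dim I \<le> vec.dim K \<longleftrightarrow> I \<subseteq> K" "vec.dim J \<le> vec.dim K \<longleftrightarrow> J \<subseteq> K"
    using sub vec.dim_subset vec.subspace_dim_equal[OF K I] vec.subspace_dim_equal[OF K J] by auto
  ultimately have "?r0 + ?n1 = ?r1 \<and> ?r0 + ?n3 = ?r2 \<longleftrightarrow> ?n1 = rank B \<and> ?n3 = 0 \<and> I \<subseteq> K \<and> J \<subseteq> K"
    by linarith
  also have "\<dots> \<longleftrightarrow> (\<exists>X. hermitian X \<and> B ** X + X ** adj B \<preceq>\<^sub>L A \<and> B ** X ** adj B = C)"
    unfolding solvable_le_iff[OF A X0] inertia_neg_M1_eq_rank_iff[OF A]
      inertia_neg_eq_0_iff[OF hermitian_M3[OF A C]] I_def J_def K_def by blast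
  finally show ?thesis by simp
qed

lemma corollary_less:
  fixes A B C :: "complex^'m^'m"
  assumes A: "hermitian A" and C: "hermitian C" and X: "\<exists>X. B ** X ** adj B = C"
  shows "(\<exists>X. hermitian X \<and> B ** X + X ** adj B \<prec>\<^sub>L A \<and> B ** X ** adj B = C) \<longleftrightarrow>
    CARD('m) \<le> inertia_pos (four_block A B (adj B) 0) \<and>
    inertia_pos (B ** A ** adj B - B ** C - C ** adj B) = rank B"
proof -
  obtain X0 where X0: "hermitian X0" "B ** X0 ** adj B = C"
    using X hermitian_solution[OF C] by blast
  \<comment> \<open>Consistency makes \<open>C\<close>, and with it this matrix, vanish on the
    kernel of \<open>adj B\<close>, as the comparison of its inertia with \<open>rank B\<close>
    requires.\<close>
  have "(B ** A ** adj B - B ** C - C ** adj B) *v x = 0" if x: "adj B *v x = 0" for x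
  proof -
    have "C *v x = 0" by (simp add: X0(2)[symmetric] x flip: matrix_vector_mul_assoc)
    then show ?thesis using x by (simp add: matrix_vector_mult_diff_rdistrib flip: matrix_vector_mul_assoc)
  qed
  then show ?thesis
    unfolding solvable_less_iff[OF A X0] inertia_pos_M1_ge_card_iff[OF A]
    using inertia_pos_eq_rank_iff[OF hermitian_M3[OF A C]] by blast
qed

lemma inertia_pos_M1_uminus:
  fixes A B :: "complex^'m^'m"
  assumes "hermitian A"
  shows "inertia_neg (four_block (- A) (- B) (adj (- B)) 0) = inertia_pos (four_block A B (adj B) 0)"
  using inertia_neg_M1[of "- A" "- B"] assms by (simp add: hermitian_minus_iff)

lemma loewner_minus:
  "- P \<preceq>\<^sub>L - Q \<longleftrightarrow> Q \<preceq>\<^sub>L P" "- P \<prec>\<^sub>L - Q \<longleftrightarrow> Q \<prec>\<^sub>L P"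
  by (auto simp: loewner_le_def loewner_less_def hermitian_minus_iff)

theorem corollary6p4:
  fixes A B C M3 :: "complex^'m^'m"
    and M1 M2 :: "complex^('m + 'm)^('m + 'm)"
  assumes "hermitian A" and "hermitian C"
    and "\<exists>X :: complex^'m^'m. B ** X ** adj B = C"
    and "M1 = four_block A B (adj B) 0"
    and "M2 = four_block (B ** A) (B ** B) (adj B) 0"
    and "M3 = B ** A ** adj B - B ** C - C ** adj B"
  shows
    "((\<exists>X. hermitian X \<and> B ** X + X ** adj B \<preceq>\<^sub>L A \<and> B ** X ** adj B = C) \<longleftrightarrow>
        int (rank (row_block (B ** B) (C - B ** A))) + int (inertia_neg M1) - int (rank M2) = 0 \<and>
        int (rank (row_block (B ** B) (C - B ** A))) + int (inertia_neg M3)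
          - int (rank (row_block (B ** B) (C ** adj B - B ** A ** adj B))) = 0)
   \<and> ((\<exists>X. hermitian X \<and> B ** X + X ** adj B \<prec>\<^sub>L A \<and> B ** X ** adj B = C) \<longleftrightarrow>
        inertia_pos M1 \<ge> CARD('m) \<and>
        inertia_pos (B ** A ** adj B - B ** C - C ** adj B) = rank B)
   \<and> ((\<exists>X. hermitian X \<and> A \<preceq>\<^sub>L B ** X + X ** adj B \<and> B ** X ** adj B = C) \<longleftrightarrow>
        int (rank (row_block (B ** B) (C - B ** A))) + int (inertia_pos M1) - int (rank M2) = 0 \<and>
        int (rank (row_block (B ** B) (C - B ** A))) + int (inertia_pos M3)
          - int (rank (row_block (B ** B) (C ** adj B - B ** A ** adj B))) = 0)
   \<and> ((\<exists>X. hermitian X \<and> A \<prec>\<^sub>L B ** X + X ** adj B \<and> B ** X ** adj B = C) \<longleftrightarrow>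
        inertia_neg M1 \<ge> CARD('m) \<and>
        inertia_neg (B ** A ** adj B - B ** C - C ** adj B) = rank B)"
proof -
  note AC = assms(1,2)
  have A': "hermitian (- A)" using AC by (simp add: hermitian_minus_iff)
  have X': "\<exists>X. (- B) ** X ** adj (- B) = C"
    using assms(3) by (simp add: adj_minus matrix_minus_left matrix_minus_right)
  have M3: "hermitian M3" unfolding assms(6) by (rule hermitian_M3[OF AC])
  have M3': "(- B) ** (- A) ** adj (- B) - (- B) ** C - C ** adj (- B) = - M3"
    by (simp add: assms(6) adj_minus matrix_minus_left matrix_minus_right)
  have lyap: "(- B) ** X + X ** adj (- B) = - (B ** X + X ** adj B)"
    and eqC: "(- B) ** X ** adj (- B) = B ** X ** adj B" for X
    by (simp_all add: adj_minus matrix_minus_left matrix_minus_right)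
  have r0: "row_block ((- B) ** (- B)) (C - (- B) ** (- A)) = row_block (B ** B) (C - B ** A)"
    by (simp add: matrix_minus_left matrix_minus_right)
  \<comment> \<open>Under the sign change only the lower left block is negated; the ranks agree
    because the left kernels lead to the same subspace of vectors \<open>w\<close>.\<close>
  have r1: "rank (four_block ((- B) ** (- A)) ((- B) ** (- B)) (adj (- B)) 0) = rank M2"
  proof -
    have "range ((*v) (- B)) = range (\<lambda>x. B *v (- x))"
      by (simp add: matrix_vector_minus_left vec.neg)
    also have "\<dots> = range ((*v) B)"
      using image_image[of "(*v) B" uminus UNIV] by simp
    finally show ?thesis
      using rank_M2[OF A', of "- B"] rank_M2[OF AC(1), of B]
      by (simp add: assms(5) adj_minus matrix_vector_minus_left rank_minus vec.neg)
  qed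
  have r2: "rank (row_block ((- B) ** (- B)) (C ** adj (- B) - (- B) ** (- A) ** adj (- B))) =
      rank (row_block (B ** B) (C ** adj B - B ** A ** adj B))"
    using rank_M3_block[OF A' AC(2), of "- B"] rank_M3_block[OF AC, of B]
    by (simp add: adj_minus matrix_vector_minus_left vec.neg)
  have iM1: "inertia_neg (four_block (- A) (- B) (adj (- B)) 0) = inertia_pos M1"
    unfolding assms(4) by (rule inertia_pos_M1_uminus[OF AC(1)])
  have iM1': "inertia_pos (four_block (- A) (- B) (adj (- B)) 0) = inertia_neg M1"
    unfolding assms(4) by (rule inertia_neg_M1[OF AC(1), symmetric])
  have iM3: "inertia_neg (- M3) = inertia_pos M3" "inertia_pos (- M3) = inertia_neg M3"
    using inertia_pos_minus[of "- M3"] inertia_pos_minus[of M3] M3 by (simp_all add: hermitian_minus_iff)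
  note a = corollary_le[OF AC assms(3), folded assms(4-6)]
  note b = corollary_less[OF AC assms(3), folded assms(4,6)]
  note c = corollary_le[OF A' AC(2) X', unfolded M3' r0 r1 r2 iM1 iM3, unfolded lyap eqC loewner_minus]
  note d = corollary_less[OF A' AC(2) X', unfolded M3' iM1' iM3 rank_minus, unfolded lyap eqC loewner_minus]
  show ?thesis
    unfolding a b c d assms(6)[symmetric] by linarith
qed

end
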